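(* Let $W$ denote a standard real-valued Brownian motion on $[0,1]$ and let $n\ge 1$. Let $W^{n}$ be the unique $n$-th degree random polynomial with a root at $0$ (i.e. $W^n_0=0$) and satisfying $$\int_{0}^{1}u^{k}\,dW_{u}^{n} = \int_{0}^{1}u^{k}\,dW_{u},\qquad k = 0,1,\ldots,n-1.$$ Then $W = W^{n} + Z^{n}$, where $Z^{n}$ is a centered Gaussian process (indexed by $[0,1]$) independent of $W^{n}$.
   Context: A random polynomial of degree $n$ is a process $t\mapsto W^n_t$, $t\in[0,1]$, of the form $\sum_{j=0}^n c_j t^j$ with random coefficients $c_j$; $dW^n_u=(W^n)'_u\,du$. The integral $\int_0^1 u^k\,dW_u$ is the Wiener integral. *)

theory Defs
  imports "HOL-Probability.Probability"
begin

text \<open>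
  Processes on \<open>[0,1]\<close> are functions \<open>real \<Rightarrow> 'a \<Rightarrow> real\<close> of which only the values at times in
  \<open>{0..1}\<close> are ever used.
\<close>

definition standard_brownian_motion :: "'a measure \<Rightarrow> (real \<Rightarrow> 'a \<Rightarrow> real) \<Rightarrow> bool" where
  "standard_brownian_motion M W \<longleftrightarrow>
     (\<forall>t\<in>{0..1}. W t \<in> borel_measurable M) \<and>
     (AE \<omega> in M. W 0 \<omega> = 0) \<and>
     (\<forall>(m::nat) (t::nat \<Rightarrow> real). 0 \<le> t 0 \<and> (\<forall>i<m. t i \<le> t (Suc i)) \<and> t m \<le> 1 \<longrightarrow>
        prob_space.indep_vars M (\<lambda>_. borel) (\<lambda>i \<omega>. W (t (Suc i)) \<omega> - W (t i) \<omega>) {..<m}) \<and>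
     (\<forall>s t. 0 \<le> s \<and> s < t \<and> t \<le> 1 \<longrightarrow>
        distributed M lborel (\<lambda>\<omega>. W t \<omega> - W s \<omega>) (normal_density 0 (sqrt (t - s)))) \<and>
     (AE \<omega> in M. continuous_on {0..1} (\<lambda>t. W t \<omega>))"

text \<open>
  A list of triples \<open>(c, a, b)\<close> encodes the step function that is the sum of the functions
  \<open>c * indicator {a<..b}\<close>; the intervals may overlap.
\<close>

type_synonym step = "(real \<times> real \<times> real) list"

definition step01 :: "step \<Rightarrow> bool" where
  "step01 \<phi> \<longleftrightarrow> (\<forall>(c, a, b)\<in>set \<phi>. 0 \<le> a \<and> a \<le> b \<and> b \<le> 1)"

definition step_fun :: "step \<Rightarrow> real \<Rightarrow> real" where
  "step_fun \<phi> u = (\<Sum>(c, a, b)\<leftarrow>\<phi>. c * indicator {a<..b} u)"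

definition step_integral :: "(real \<Rightarrow> 'a \<Rightarrow> real) \<Rightarrow> step \<Rightarrow> 'a \<Rightarrow> real" where
  "step_integral W \<phi> \<omega> = (\<Sum>(c, a, b)\<leftarrow>\<phi>. c * (W b \<omega> - W a \<omega>))"

text \<open>
  The Wiener integral over \<open>[0,1]\<close>: the limit in \<open>L\<^sup>2(M)\<close> of the integrals of step functions that
  converge to the integrand in \<open>L\<^sup>2([0,1])\<close>. By the isometry property, the limit does not depend on
  the approximating sequence, and it is determined up to a null set.
\<close>

definition has_wiener_integral ::
    "'a measure \<Rightarrow> (real \<Rightarrow> 'a \<Rightarrow> real) \<Rightarrow> (real \<Rightarrow> real) \<Rightarrow> ('a \<Rightarrow> real) \<Rightarrow> bool" where
  "has_wiener_integral M W f I \<longleftrightarrow>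
     f \<in> borel_measurable borel \<and> I \<in> borel_measurable M \<and>
     (\<exists>\<phi> :: nat \<Rightarrow> step. (\<forall>m. step01 (\<phi> m)) \<and>
        (\<lambda>m. \<integral>\<^sup>+u\<in>{0..1}. ennreal ((step_fun (\<phi> m) u - f u)\<^sup>2) \<partial>lborel) \<longlonglongrightarrow> 0 \<and>
        (\<lambda>m. \<integral>\<^sup>+\<omega>. ennreal ((step_integral W (\<phi> m) \<omega> - I \<omega>)\<^sup>2) \<partial>M) \<longlonglongrightarrow> 0)"

text \<open>A fixed version of the Wiener integral; statements about it have to be almost sure ones.\<close>

definition wiener_integral ::
    "'a measure \<Rightarrow> (real \<Rightarrow> 'a \<Rightarrow> real) \<Rightarrow> (real \<Rightarrow> real) \<Rightarrow> 'a \<Rightarrow> real" where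
  "wiener_integral M W f = (SOME I. has_wiener_integral M W f I)"

definition random_polynomial :: "'a measure \<Rightarrow> nat \<Rightarrow> (real \<Rightarrow> 'a \<Rightarrow> real) \<Rightarrow> bool" where
  "random_polynomial M n X \<longleftrightarrow>
     (\<exists>c :: nat \<Rightarrow> 'a \<Rightarrow> real. (\<forall>j\<le>n. c j \<in> borel_measurable M) \<and>
        (\<forall>t\<in>{0..1}. \<forall>\<omega>\<in>space M. X t \<omega> = (\<Sum>j\<le>n. c j \<omega> * t ^ j)))"

text \<open>The pathwise integral of \<open>f\<close> against \<open>dX\<^sub>u = X'\<^sub>u du\<close>; the derivative is one-sided at 0 and 1.\<close>

definition pathwise_integral ::
    "(real \<Rightarrow> 'a \<Rightarrow> real) \<Rightarrow> (real \<Rightarrow> real) \<Rightarrow> 'a \<Rightarrow> real" where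
  "pathwise_integral X f \<omega> =
     (LBINT u:{0..1}. f u * vector_derivative (\<lambda>s. X s \<omega>) (at u within {0..1}))"

definition matches_moments ::
    "'a measure \<Rightarrow> (real \<Rightarrow> 'a \<Rightarrow> real) \<Rightarrow> nat \<Rightarrow> (real \<Rightarrow> 'a \<Rightarrow> real) \<Rightarrow> bool" where
  "matches_moments M W n X \<longleftrightarrow>
     random_polynomial M n X \<and>
     (AE \<omega> in M. X 0 \<omega> = 0) \<and>
     (\<forall>k<n. AE \<omega> in M.
        pathwise_integral X (\<lambda>u. u ^ k) \<omega> = wiener_integral M W (\<lambda>u. u ^ k) \<omega>)"

text \<open>Constants count as Gaussian, with standard deviation 0.\<close>

definition gaussian_rv :: "'a measure \<Rightarrow> ('a \<Rightarrow> real) \<Rightarrow> bool" where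
  "gaussian_rv M X \<longleftrightarrow>
     X \<in> borel_measurable M \<and>
     (\<exists>\<mu> \<sigma>. 0 < \<sigma> \<and> distributed M lborel X (normal_density \<mu> \<sigma>) \<or> (AE \<omega> in M. X \<omega> = \<mu>))"

definition gaussian_process :: "'a measure \<Rightarrow> real set \<Rightarrow> (real \<Rightarrow> 'a \<Rightarrow> real) \<Rightarrow> bool" where
  "gaussian_process M T X \<longleftrightarrow>
     (\<forall>S a. finite S \<and> S \<subseteq> T \<longrightarrow> gaussian_rv M (\<lambda>\<omega>. \<Sum>t\<in>S. a t * X t \<omega>))"

definition centered_process :: "'a measure \<Rightarrow> real set \<Rightarrow> (real \<Rightarrow> 'a \<Rightarrow> real) \<Rightarrow> bool" where
  "centered_process M T X \<longleftrightarrow>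
     (\<forall>t\<in>T. integrable M (X t) \<and> integral\<^sup>L M (X t) = 0)"

text \<open>Each process, as a whole path, is a random variable with values in the product space.\<close>

definition independent_processes ::
    "'a measure \<Rightarrow> real set \<Rightarrow> (real \<Rightarrow> 'a \<Rightarrow> real) \<Rightarrow> (real \<Rightarrow> 'a \<Rightarrow> real) \<Rightarrow> bool" where
  "independent_processes M T X Y \<longleftrightarrow>
     prob_space.indep_var M
       (PiM T (\<lambda>_. borel)) (\<lambda>\<omega>. \<lambda>t\<in>T. X t \<omega>)
       (PiM T (\<lambda>_. borel)) (\<lambda>\<omega>. \<lambda>t\<in>T. Y t \<omega>)"

end

theory Submission
  imports Defs "Jordan_Normal_Form.Determinant"
begin

text \<open>
  Write \<open>\<xi>\<^sub>k\<close> for the Wiener integral of \<open>u\<^sup>k\<close>. Everything happens in the Gaussian space of Wiener integrals,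
  which is an isometric image of \<open>L\<^sup>2([0,1])\<close>. The value \<open>W\<^sub>t\<close> is the integral of the indicator of \<open>(0,t]\<close>. The
  moment conditions are a linear system for the coefficients of the derivative of \<open>W\<^sup>n\<close>, whose matrix is
  the Hilbert matrix \<open>1 / (k + l + 1)\<close>. This is the Gram matrix of the monomials, so it is invertible
  (\<open>hilbert_matrix_inverse\<close>), which gives existence and uniqueness and shows that \<open>W\<^sup>n\<^sub>t\<close> is a fixed
  linear combination of the \<open>\<xi>\<^sub>k\<close>, that is, the Wiener integral of a polynomial \<open>q\<^sub>t\<close> of degree below \<open>n\<close>.
  This \<open>q\<^sub>t\<close> is the orthogonal projection of the indicator of \<open>(0,t]\<close> onto such polynomials
  (\<open>interpolation_residual_orthogonal\<close>). So the values of \<open>Z = W - W\<^sup>n\<close> are Wiener integrals of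
  functions orthogonal to all \<open>q\<^sub>s\<close>: the processes \<open>Z\<close> and \<open>W\<^sup>n\<close> are jointly Gaussian and uncorrelated, hence
  independent.

  Gaussianity is expressed by characteristic functions. For a step function the Wiener integral is a sum
  of independent normal increments (\<open>step_integral_centered_normal\<close>), and the formula
  \<open>E exp (\<i> s I) = exp (- s\<^sup>2 \<parallel>f\<parallel>\<^sup>2 / 2)\<close> for the integral \<open>I\<close> of \<open>f\<close> passes to limits in \<open>L\<^sup>2\<close>
  (\<open>wiener_integral_normal\<close>). The integrals of monomials exist by completeness
  (\<open>has_wiener_integral_continuous\<close>). By Pythagoras, the joint characteristic function of finitely many
  values of \<open>Z\<close> and of \<open>W\<^sup>n\<close> is a product. That this implies independence of the whole paths
  (\<open>independent_processes_of_char\<close>) is deduced from the uniqueness theorem for characteristic functions on the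
  real line, applied in one coordinate at a time.
\<close>

section \<open>Centered normal random variables\<close>

text \<open>
  The characteristic function describes all normal laws \<open>N(0, v)\<close> at once, including the
  degenerate one with \<open>v = 0\<close>, which has no density. It is also the form in which normality
  passes to limits and in which independence can be read off.
\<close>

definition centered_normal :: "'a measure \<Rightarrow> real \<Rightarrow> ('a \<Rightarrow> real) \<Rightarrow> bool" where
  "centered_normal M v X \<longleftrightarrow> 0 \<le> v \<and> X \<in> borel_measurable M \<and>
     (\<forall>s. (CLINT \<omega>|M. iexp (s * X \<omega>)) = exp (- (v * s\<^sup>2) / 2))"

text \<open>
  Rescaling by \<open>\<sigma>\<close> reduces this to the standard normal law.
\<close>

lemma char_normal_density:
  assumes "0 < \<sigma>"
  shows "char (density lborel (normal_density 0 \<sigma>)) s = exp (- (\<sigma>\<^sup>2 * s\<^sup>2) / 2)"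
proof -
  let ?N = "density lborel (normal_density 0 \<sigma>)"
  interpret N: prob_space ?N by (rule prob_space_normal_density) fact
  have "distributed ?N lborel (\<lambda>x. x) (normal_density 0 \<sigma>)"
    by (simp add: distributed_def distr_id2)
  then have "distributed ?N lborel (\<lambda>x. x / \<sigma>) std_normal_density"
    using N.normal_standard_normal_convert[of \<sigma> "\<lambda>x. x" 0] assms by simp
  then have eq: "distr ?N lborel (\<lambda>x. x / \<sigma>) = std_normal_distribution"
    by (rule distributed_distr_eq_density)
  have "char ?N s = (CLINT x|?N. iexp ((s * \<sigma>) * (x / \<sigma>)))"
    using assms by (simp add: char_def)
  also have "\<dots> = (CLINT y|distr ?N lborel (\<lambda>x. x / \<sigma>). iexp ((s * \<sigma>) * y))"
    by (subst integral_distr) auto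
  also have "\<dots> = char std_normal_distribution (s * \<sigma>)"
    unfolding eq char_def ..
  finally show ?thesis
    unfolding char_std_normal_distribution by (simp add: power_mult_distrib mult.commute)
qed

lemma char_distr_eq:
  assumes "X \<in> borel_measurable M"
  shows "char (distr M borel X) s = (CLINT \<omega>|M. iexp (s * X \<omega>))"
  unfolding char_def using assms by (subst integral_distr) auto

context prob_space
begin

lemma real_distribution_distr_borel:
  "X \<in> borel_measurable M \<Longrightarrow> real_distribution (distr M borel X)"
  by (simp add: real_distribution_def real_distribution_axioms_def prob_space_distr)

lemma centered_normal_of_distributed:
  assumes "0 < \<sigma>" "distributed M lborel X (normal_density 0 \<sigma>)"
  shows "centered_normal M (\<sigma>\<^sup>2) X"
proof -
  have X: "X \<in> borel_measurable M"
    using distributed_measurable[OF assms(2)] by simp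
  have "distr M borel X = distr M lborel X"
    by (rule distr_cong) auto
  also have "\<dots> = density lborel (normal_density 0 \<sigma>)"
    using assms(2) by (rule distributed_distr_eq_density)
  finally show ?thesis
    using X char_normal_density[OF assms(1)] char_distr_eq[OF X]
    by (simp add: centered_normal_def)
qed

lemma distributed_of_centered_normal:
  assumes "centered_normal M v X" "0 < v"
  shows "distributed M lborel X (normal_density 0 (sqrt v))"
proof -
  have X: "X \<in> borel_measurable M" using assms by (simp add: centered_normal_def)
  have rd: "real_distribution (density lborel (normal_density 0 (sqrt v)))"
    using assms(2) prob_space_normal_density[of "sqrt v" 0]
    by (simp add: real_distribution_def real_distribution_axioms_def)
  have "distr M borel X = density lborel (normal_density 0 (sqrt v))"
    using assms
    by (intro Levy_uniqueness real_distribution_distr_borel X rd ext)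
       (simp add: char_distr_eq X char_normal_density centered_normal_def)
  moreover have "distr M borel X = distr M lborel X"
    by (rule distr_cong) auto
  ultimately show ?thesis using X by (simp add: distributed_def)
qed

lemma AE_zero_of_centered_normal:
  assumes "centered_normal M 0 X"
  shows "AE \<omega> in M. X \<omega> = 0"
proof -
  have X[measurable]: "X \<in> borel_measurable M" using assms by (simp add: centered_normal_def)
  have Z: "(\<lambda>_. 0) \<in> borel_measurable M" by simp
  have eq: "distr M borel X = distr M borel (\<lambda>_. 0)"
    using assms
    by (intro Levy_uniqueness real_distribution_distr_borel X Z ext)
       (simp add: char_distr_eq[OF X] char_distr_eq[OF Z] centered_normal_def prob_space
             del: distr_const)
  have "AE x in distr M borel (\<lambda>_. 0::real). x = 0"
    by (subst AE_distr_iff) auto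
  then have "AE x in distr M borel X. x = 0" by (simp only: eq)
  then show ?thesis by (subst (asm) AE_distr_iff) auto
qed

text \<open>
  The second moment is an extended integral because it is compared below with the integrals that
  define \<open>L\<^sup>2\<close> convergence. Combined with the law of the integral of a step function,
  it gives the isometry between step functions and their integrals.
\<close>

lemma centered_normal_moments:
  assumes "centered_normal M v X"
  shows "integrable M X" "expectation X = 0" "(\<integral>\<^sup>+\<omega>. ennreal ((X \<omega>)\<^sup>2) \<partial>M) = ennreal v"
proof -
  have X[measurable]: "X \<in> borel_measurable M" and "0 \<le> v"
    using assms by (simp_all add: centered_normal_def)
  have "integrable M X \<and> expectation X = 0 \<and> (\<integral>\<^sup>+\<omega>. ennreal ((X \<omega>)\<^sup>2) \<partial>M) = ennreal v"
  proof (cases "v = 0")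
    case True
    then have ae: "AE \<omega> in M. X \<omega> = 0" using assms AE_zero_of_centered_normal by simp
    have "integrable M X" using ae by (subst integrable_cong_AE[where g="\<lambda>_. 0"]) auto
    moreover have "expectation X = 0" using ae by (subst integral_cong_AE[where g="\<lambda>_. 0"]) auto
    moreover have "(\<integral>\<^sup>+\<omega>. ennreal ((X \<omega>)\<^sup>2) \<partial>M) = (\<integral>\<^sup>+\<omega>. 0 \<partial>M)"
      by (rule nn_integral_cong_AE) (use ae in auto)
    ultimately show ?thesis using True by simp
  next
    case False
    then have v: "0 < v" "0 < sqrt v" using \<open>0 \<le> v\<close> by auto
    note D = distributed_of_centered_normal[OF assms v(1)]
    have "integrable M (\<lambda>\<omega>. X \<omega>)"
      using integrable_normal_moment_nz_1[OF v(2), of 0]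
      by (subst distributed_integrable[OF D, symmetric]) auto
    moreover have E: "expectation X = 0" by (rule normal_distributed_expectation[OF v(2) D])
    moreover have "integrable M (\<lambda>\<omega>. (X \<omega>)\<^sup>2)"
      using integrable_normal_moment[OF v(2), of 0 2]
      by (subst distributed_integrable[OF D, symmetric]) auto
    then have "(\<integral>\<^sup>+\<omega>. ennreal ((X \<omega>)\<^sup>2) \<partial>M) = ennreal (expectation (\<lambda>\<omega>. (X \<omega>)\<^sup>2))"
      by (rule nn_integral_eq_integral) simp
    moreover have "expectation (\<lambda>\<omega>. (X \<omega>)\<^sup>2) = v"
      using normal_distributed_variance[OF v(2) D] E v by simp
    ultimately show ?thesis by simp
  qed
  then show "integrable M X" "expectation X = 0"
    "(\<integral>\<^sup>+\<omega>. ennreal ((X \<omega>)\<^sup>2) \<partial>M) = ennreal v" by auto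
qed

lemma gaussian_rv_of_centered_normal:
  assumes "centered_normal M v X"
  shows "gaussian_rv M X"
proof (cases "v = 0")
  case True
  then show ?thesis
    using assms AE_zero_of_centered_normal by (auto simp: gaussian_rv_def centered_normal_def)
next
  case False
  then have "0 < v" using assms by (simp add: centered_normal_def)
  then have "0 < sqrt v \<and> distributed M lborel X (normal_density 0 (sqrt v))"
    using distributed_of_centered_normal[OF assms] by simp
  then show ?thesis
    using assms unfolding gaussian_rv_def centered_normal_def by blast
qed

end

section \<open>Independence from characteristic functions\<close>

context prob_space
begin

text \<open>
  Uniqueness of characteristic functions extends from probability measures to measures with a
  bounded signed density \<open>h\<close>. If \<open>\<bar>h\<bar> \<le> D\<close>, then \<open>1 + h / D\<close> is the density of a probability
  measure, because \<open>h\<close> has mean zero, which is the hypothesis at \<open>s = 0\<close>. Under this measure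
  \<open>X\<close> has the same characteristic function as before, hence the same law.
\<close>

lemma expectation_indicator_eq_0_real:
  fixes h X :: "'a \<Rightarrow> real"
  assumes [measurable]: "h \<in> borel_measurable M" "X \<in> borel_measurable M" "A \<in> sets borel"
    and bound: "\<And>\<omega>. \<omega> \<in> space M \<Longrightarrow> \<bar>h \<omega>\<bar> \<le> C"
    and zero: "\<And>s. (CLINT \<omega>|M. complex_of_real (h \<omega>) * iexp (s * X \<omega>)) = 0"
  shows "expectation (\<lambda>\<omega>. h \<omega> * indicator A (X \<omega>)) = 0"
proof -
  define D where "D = max C 1"
  have D: "0 < D" and bD: "\<bar>h \<omega>\<bar> \<le> D" if "\<omega> \<in> space M" for \<omega>
    using bound[OF that] by (auto simp: D_def)
  have D0: "0 < D" by (simp add: D_def)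
  have nn: "0 \<le> 1 + h \<omega> / D" if "\<omega> \<in> space M" for \<omega>
    using bD[OF that] D0 by (simp add: field_simps abs_le_iff)
  have int_h: "integrable M h"
    using bD by (intro integrable_const_bound[where B=D]) auto
  have "complex_of_real (expectation h) = 0"
    using zero[of 0] by simp
  then have Eh: "expectation h = 0" by simp
  define N where "N = density M (\<lambda>\<omega>. ennreal (1 + h \<omega> / D))"
  have [measurable_cong]: "sets N = sets M" and spN: "space N = space M" by (simp_all add: N_def)
  have "(\<integral>\<^sup>+\<omega>. ennreal (1 + h \<omega> / D) \<partial>M) = ennreal (expectation (\<lambda>\<omega>. 1 + h \<omega> / D))"
    using int_h nn by (intro nn_integral_eq_integral) auto
  also have "expectation (\<lambda>\<omega>. 1 + h \<omega> / D) = 1"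
    using int_h Eh by (subst Bochner_Integration.integral_add) (auto simp: prob_space)
  finally have "emeasure N (space N) = 1"
    unfolding N_def by (simp add: emeasure_density cong: nn_integral_cong)
  then interpret N: prob_space N by (rule prob_spaceI)
  have int_N: "(LINT \<omega>|N. g \<omega>) = (LINT \<omega>|M. g \<omega>) + (1/D) *\<^sub>R (LINT \<omega>|M. h \<omega> *\<^sub>R g \<omega>)"
    if [measurable]: "g \<in> borel_measurable M" and g: "\<And>\<omega>. norm (g \<omega>) \<le> 1"
    for g :: "'a \<Rightarrow> complex"
  proof -
    have "(LINT \<omega>|N. g \<omega>) = (LINT \<omega>|M. (1 + h \<omega> / D) *\<^sub>R g \<omega>)"
      unfolding N_def using nn by (subst integral_density) auto
    also have "\<dots> = (LINT \<omega>|M. g \<omega> + (1/D) *\<^sub>R (h \<omega> *\<^sub>R g \<omega>))"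
      by (simp add: scaleR_add_left)
    also have "\<dots> = (LINT \<omega>|M. g \<omega>) + (LINT \<omega>|M. (1/D) *\<^sub>R (h \<omega> *\<^sub>R g \<omega>))"
    proof (rule Bochner_Integration.integral_add)
      show "integrable M g" using g by (intro integrable_const_bound[where B=1]) auto
      have "norm (h \<omega> *\<^sub>R g \<omega>) \<le> D" if "\<omega> \<in> space M" for \<omega>
        using mult_mono[OF bD[OF that] g[of \<omega>]] D0 by simp
      then have "integrable M (\<lambda>\<omega>. h \<omega> *\<^sub>R g \<omega>)"
        by (intro integrable_const_bound[where B=D]) auto
      then show "integrable M (\<lambda>\<omega>. (1/D) *\<^sub>R (h \<omega> *\<^sub>R g \<omega>))"
        by (rule integrable_scaleR_right)
    qed
    finally show ?thesis by (simp only: integral_scaleR_right)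
  qed
  have XN: "X \<in> borel_measurable N" by measurable
  have "distr N borel X = distr M borel X"
  proof (rule Levy_uniqueness[OF N.real_distribution_distr_borel[OF XN]
        real_distribution_distr_borel ext])
    fix s
    have "char (distr N borel X) s = (CLINT \<omega>|N. iexp (s * X \<omega>))"
      by (simp add: char_def integral_distr)
    also have "\<dots> = (CLINT \<omega>|M. iexp (s * X \<omega>)) + (1/D) *\<^sub>R (CLINT \<omega>|M. h \<omega> *\<^sub>R iexp (s * X \<omega>))"
      by (rule int_N) auto
    also have "\<dots> = char (distr M borel X) s"
      using zero[of s] by (simp add: char_def integral_distr scaleR_conv_of_real)
    finally show "char (distr N borel X) s = char (distr M borel X) s" .
  qed auto
  then have "(CLINT x|distr N borel X. indicator A x) = (CLINT x|distr M borel X. indicator A x)"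
    by simp
  then have "(CLINT \<omega>|N. indicator A (X \<omega>)) = (CLINT \<omega>|M. indicator A (X \<omega>))"
    by (simp add: integral_distr)
  then have "(CLINT \<omega>|M. h \<omega> *\<^sub>R indicator A (X \<omega>)) = 0"
    using int_N[of "\<lambda>\<omega>. indicator A (X \<omega>)"] D0 by (auto simp: indicator_def)
  moreover have "(CLINT \<omega>|M. h \<omega> *\<^sub>R indicator A (X \<omega>)) =
      (CLINT \<omega>|M. complex_of_real (h \<omega> * indicator A (X \<omega>)))"
    by (intro Bochner_Integration.integral_cong) (auto simp: indicator_def scaleR_conv_of_real)
  ultimately show ?thesis by (simp del: of_real_mult)
qed

text \<open>
  The hypothesis holds for all real \<open>s\<close>, so complex conjugation turns it into the same hypothesis
  for \<open>cnj H\<close>. Hence it holds for the real and the imaginary part of \<open>H\<close> separately.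
\<close>

lemma expectation_indicator_eq_0:
  fixes H :: "'a \<Rightarrow> complex" and X :: "'a \<Rightarrow> real"
  assumes [measurable]: "H \<in> borel_measurable M" "X \<in> borel_measurable M" "A \<in> sets borel"
    and bound: "\<And>\<omega>. \<omega> \<in> space M \<Longrightarrow> norm (H \<omega>) \<le> C"
    and zero: "\<And>s. (CLINT \<omega>|M. H \<omega> * iexp (s * X \<omega>)) = 0"
  shows "(CLINT \<omega>|M. H \<omega> * indicator A (X \<omega>)) = 0"
proof -
  have cnj_cont: "cnj \<in> borel_measurable borel"
    by (intro borel_measurable_continuous_onI continuous_intros)
  have [measurable]: "(\<lambda>\<omega>. cnj (H \<omega>)) \<in> borel_measurable M"
    by (rule measurable_compose[OF assms(1) cnj_cont])
  have int: "integrable M (\<lambda>\<omega>. H \<omega> * iexp (s * X \<omega>))"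
       "integrable M (\<lambda>\<omega>. cnj (H \<omega>) * iexp (s * X \<omega>))" for s
    using bound by (auto intro!: integrable_const_bound[where B=C] simp: norm_mult)
  have zero': "(CLINT \<omega>|M. cnj (H \<omega>) * iexp (s * X \<omega>)) = 0" for s
  proof -
    have "(CLINT \<omega>|M. cnj (H \<omega>) * iexp (s * X \<omega>)) = cnj (CLINT \<omega>|M. H \<omega> * iexp (- s * X \<omega>))"
      by (subst Bochner_Integration.integral_cnj[symmetric]) (simp add: exp_cnj)
    also have "\<dots> = 0" by (subst zero) simp
    finally show ?thesis .
  qed
  have "expectation (\<lambda>\<omega>. Re (H \<omega>) * indicator A (X \<omega>)) = 0"
  proof (rule expectation_indicator_eq_0_real)
    fix s
    have "(CLINT \<omega>|M. complex_of_real (Re (H \<omega>)) * iexp (s * X \<omega>)) =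
      (CLINT \<omega>|M. (H \<omega> * iexp (s * X \<omega>) + cnj (H \<omega>) * iexp (s * X \<omega>)) / 2)"
      by (intro Bochner_Integration.integral_cong)
        (auto simp: distrib_right[symmetric] complex_add_cnj)
    also have "\<dots> = 0" using int zero zero' by simp
    finally show "(CLINT \<omega>|M. complex_of_real (Re (H \<omega>)) * iexp (s * X \<omega>)) = 0" .
  qed (use bound abs_Re_le_cmod order_trans in \<open>auto, blast\<close>)
  moreover have "expectation (\<lambda>\<omega>. Im (H \<omega>) * indicator A (X \<omega>)) = 0"
  proof (rule expectation_indicator_eq_0_real)
    fix s
    have "(CLINT \<omega>|M. complex_of_real (Im (H \<omega>)) * iexp (s * X \<omega>)) =
      (CLINT \<omega>|M. (H \<omega> * iexp (s * X \<omega>) - cnj (H \<omega>) * iexp (s * X \<omega>)) / (2 * \<i>))"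
    proof (rule Bochner_Integration.integral_cong[OF refl])
      fix \<omega>
      have "H \<omega> * w - cnj (H \<omega>) * w = (2 * \<i>) * (complex_of_real (Im (H \<omega>)) * w)" for w
        by (simp add: left_diff_distrib[symmetric] complex_diff_cnj)
      then show "complex_of_real (Im (H \<omega>)) * iexp (s * X \<omega>) =
          (H \<omega> * iexp (s * X \<omega>) - cnj (H \<omega>) * iexp (s * X \<omega>)) / (2 * \<i>)"
        by simp
    qed
    also have "\<dots> = 0" using int zero zero' by simp
    finally show "(CLINT \<omega>|M. complex_of_real (Im (H \<omega>)) * iexp (s * X \<omega>)) = 0" .
  qed (use bound abs_Im_le_cmod order_trans in \<open>auto, blast\<close>)
  moreover have "integrable M (\<lambda>\<omega>. H \<omega> * indicator A (X \<omega>))"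
    using bound order_trans[OF norm_ge_zero bound]
    by (intro integrable_const_bound[where B=C]) (auto simp: norm_mult indicator_def)
  then have "Re (CLINT \<omega>|M. H \<omega> * indicator A (X \<omega>)) = expectation (\<lambda>\<omega>. Re (H \<omega> * indicator A (X \<omega>)))"
    "Im (CLINT \<omega>|M. H \<omega> * indicator A (X \<omega>)) = expectation (\<lambda>\<omega>. Im (H \<omega> * indicator A (X \<omega>)))"
    by (rule integral_Re[symmetric], rule integral_Im[symmetric])
  moreover have "Re (H \<omega> * indicator A (X \<omega>)) = Re (H \<omega>) * indicator A (X \<omega>)"
    "Im (H \<omega> * indicator A (X \<omega>)) = Im (H \<omega>) * indicator A (X \<omega>)" for \<omega>
    by (auto simp: indicator_def)
  ultimately show ?thesis by (simp add: complex_eq_iff)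
qed

text \<open>
  This replaces uniqueness of characteristic functions in several dimensions: the exponentials are
  exchanged for indicators one coordinate at a time. The coordinates that are not yet treated, as
  well as those already exchanged, are absorbed into the bounded factor \<open>H\<close>, which is why \<open>H\<close> is
  complex and arbitrary in the induction.
\<close>

lemma expectation_prod_indicator_eq_0:
  fixes H :: "'a \<Rightarrow> complex" and X :: "'i \<Rightarrow> 'a \<Rightarrow> real"
  assumes "finite J" "H \<in> borel_measurable M"
    and "\<And>\<omega>. \<omega> \<in> space M \<Longrightarrow> norm (H \<omega>) \<le> C"
    and "\<And>j. j \<in> J \<Longrightarrow> X j \<in> borel_measurable M"
    and "\<And>j. j \<in> J \<Longrightarrow> A j \<in> sets borel"
    and "\<And>a. (CLINT \<omega>|M. H \<omega> * iexp (\<Sum>j\<in>J. a j * X j \<omega>)) = 0"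
  shows "(CLINT \<omega>|M. H \<omega> * (\<Prod>j\<in>J. indicator (A j) (X j \<omega>))) = 0"
  using assms
proof (induction J arbitrary: H rule: finite_induct)
  case empty
  then show ?case by simp
next
  case (insert k J)
  have [measurable]: "H \<in> borel_measurable M" "\<And>j. j \<in> J \<Longrightarrow> X j \<in> borel_measurable M"
      "X k \<in> borel_measurable M" "\<And>j. j \<in> J \<Longrightarrow> A j \<in> sets borel" "A k \<in> sets borel"
    using insert.prems by auto
  let ?P = "\<lambda>\<omega>. \<Prod>j\<in>J. indicator (A j) (X j \<omega>) :: complex"
  have meas[measurable]: "?P \<in> borel_measurable M" by measurable
  have "(CLINT \<omega>|M. (H \<omega> * ?P \<omega>) * indicator (A k) (X k \<omega>)) = 0"
  proof (rule expectation_indicator_eq_0)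
    fix \<omega> assume "\<omega> \<in> space M"
    have "norm (?P \<omega>) \<le> (\<Prod>j\<in>J. 1)"
      by (subst prod_norm[symmetric], rule prod_mono) (auto simp: indicator_def)
    then show "norm (H \<omega> * ?P \<omega>) \<le> C"
      using insert.prems(2)[OF \<open>\<omega> \<in> space M\<close>] mult_mono[of "norm (H \<omega>)" C "norm (?P \<omega>)" 1]
        order_trans[OF norm_ge_zero insert.prems(2)[OF \<open>\<omega> \<in> space M\<close>]]
      by (simp add: norm_mult)
  next
    fix s
    have "(CLINT \<omega>|M. (H \<omega> * iexp (s * X k \<omega>)) * ?P \<omega>) = 0"
    proof (rule insert.IH)
      fix a
      have "(CLINT \<omega>|M. H \<omega> * iexp (s * X k \<omega>) * iexp (\<Sum>j\<in>J. a j * X j \<omega>)) =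
        (CLINT \<omega>|M. H \<omega> * iexp (\<Sum>j\<in>insert k J. (a(k := s)) j * X j \<omega>))"
      proof (rule Bochner_Integration.integral_cong[OF refl])
        fix \<omega>
        have "(\<Sum>j\<in>J. (a(k := s)) j * X j \<omega>) = (\<Sum>j\<in>J. a j * X j \<omega>)"
          using insert.hyps by (intro sum.cong) auto
        then have "(\<Sum>j\<in>insert k J. (a(k := s)) j * X j \<omega>) = s * X k \<omega> + (\<Sum>j\<in>J. a j * X j \<omega>)"
          using insert.hyps by simp
        then show "H \<omega> * iexp (s * X k \<omega>) * iexp (\<Sum>j\<in>J. a j * X j \<omega>) =
            H \<omega> * iexp (\<Sum>j\<in>insert k J. (a(k := s)) j * X j \<omega>)"
          by (simp only: of_real_add distrib_left exp_add mult.assoc)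
      qed
      also have "\<dots> = 0" by (rule insert.prems)
      finally show "(CLINT \<omega>|M. H \<omega> * iexp (s * X k \<omega>) * iexp (\<Sum>j\<in>J. a j * X j \<omega>)) = 0" .
    qed (use insert.prems in \<open>auto simp: norm_mult\<close>)
    then show "(CLINT \<omega>|M. (H \<omega> * ?P \<omega>) * iexp (s * X k \<omega>)) = 0"
      by (simp only: mult.assoc mult.commute[of "?P _"])
  qed measurable
  then show ?case using insert.hyps by (simp add: mult_ac)
qed

lemma prod_indicator_eq:
  assumes "finite J" "\<omega> \<in> space M"
  shows "(\<Prod>j\<in>J. indicator (A j) (X j \<omega>)) =
    (indicator {\<omega>\<in>space M. \<forall>j\<in>J. X j \<omega> \<in> A j} \<omega> :: complex)"
proof (cases "\<forall>j\<in>J. X j \<omega> \<in> A j")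
  case True
  then show ?thesis using assms by (simp add: prod.neutral)
next
  case False
  then have "(\<Prod>j\<in>J. indicator (A j) (X j \<omega>)) = (0 :: complex)"
    using assms by (intro prod_zero) (auto simp: indicator_def)
  with False show ?thesis by simp
qed

text \<open>
  The factorization of the joint characteristic function says that \<open>G - E G\<close>, for
  \<open>G = exp (\<i> \<Sum> b\<^sub>k Y\<^sub>k)\<close>, is orthogonal to all exponentials in the \<open>X\<^sub>j\<close>. So it is orthogonal to
  indicators \<open>P\<close> of cylinders in the \<open>X\<^sub>j\<close>. Read the other way round, \<open>P - E P\<close> is
  orthogonal to all exponentials in the \<open>Y\<^sub>k\<close>, and therefore to indicators of cylinders in them.
\<close>

lemma prob_cylinders_of_char:
  fixes X Y :: "'i \<Rightarrow> 'a \<Rightarrow> real"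
  assumes fin: "finite J" "finite K"
    and meas: "\<And>j. j \<in> J \<Longrightarrow> X j \<in> borel_measurable M" "\<And>k. k \<in> K \<Longrightarrow> Y k \<in> borel_measurable M"
    and sets: "\<And>j. j \<in> J \<Longrightarrow> A j \<in> sets borel" "\<And>k. k \<in> K \<Longrightarrow> B k \<in> sets borel"
    and char: "\<And>a b. (CLINT \<omega>|M. iexp (\<Sum>j\<in>J. a j * X j \<omega>) * iexp (\<Sum>k\<in>K. b k * Y k \<omega>)) =
      (CLINT \<omega>|M. iexp (\<Sum>j\<in>J. a j * X j \<omega>)) * (CLINT \<omega>|M. iexp (\<Sum>k\<in>K. b k * Y k \<omega>))"
  shows "prob ({\<omega>\<in>space M. \<forall>j\<in>J. X j \<omega> \<in> A j} \<inter> {\<omega>\<in>space M. \<forall>k\<in>K. Y k \<omega> \<in> B k}) =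
    prob {\<omega>\<in>space M. \<forall>j\<in>J. X j \<omega> \<in> A j} * prob {\<omega>\<in>space M. \<forall>k\<in>K. Y k \<omega> \<in> B k}"
proof -
  note [measurable] = meas sets
  define EA where "EA = {\<omega>\<in>space M. \<forall>j\<in>J. X j \<omega> \<in> A j}"
  define EB where "EB = {\<omega>\<in>space M. \<forall>k\<in>K. Y k \<omega> \<in> B k}"
  have [measurable]: "EA \<in> events" "EB \<in> events"
    unfolding EA_def EB_def using fin by measurable
  define P :: "'a \<Rightarrow> complex" where "P = indicator EA"
  define Q :: "'a \<Rightarrow> complex" where "Q = indicator EB"
  have P: "(\<Prod>j\<in>J. indicator (A j) (X j \<omega>)) = P \<omega>" if "\<omega> \<in> space M" for \<omega>
    using prod_indicator_eq[OF fin(1) that] by (simp add: P_def EA_def)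
  have Q: "(\<Prod>k\<in>K. indicator (B k) (Y k \<omega>)) = Q \<omega>" if "\<omega> \<in> space M" for \<omega>
    using prod_indicator_eq[OF fin(2) that] by (simp add: Q_def EB_def)
  have [measurable]: "P \<in> borel_measurable M" "Q \<in> borel_measurable M"
    by (simp_all add: P_def Q_def)
  have bP: "norm (P \<omega>) \<le> 1" and bQ: "norm (Q \<omega>) \<le> 1" for \<omega>
    by (auto simp: P_def Q_def indicator_def)
  have intb: "integrable M g" if "g \<in> borel_measurable M" "\<And>\<omega>. norm (g \<omega>) \<le> 1" for g :: "'a \<Rightarrow> complex"
    using that by (intro integrable_const_bound[where B=1]) auto
  have nE: "norm (expectation g) \<le> 1" if "g \<in> borel_measurable M" "\<And>\<omega>. norm (g \<omega>) \<le> 1" for g :: "'a \<Rightarrow> complex"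
  proof -
    have "norm (expectation g) \<le> expectation (\<lambda>\<omega>. norm (g \<omega>))" by (rule integral_norm_bound)
    also have "\<dots> \<le> expectation (\<lambda>_. 1)"
      using intb[OF that] that by (intro integral_mono) auto
    finally show ?thesis by (simp add: prob_space)
  qed
  have step1: "(CLINT \<omega>|M. P \<omega> * iexp (\<Sum>k\<in>K. b k * Y k \<omega>)) =
      expectation P * (CLINT \<omega>|M. iexp (\<Sum>k\<in>K. b k * Y k \<omega>))" for b
  proof -
    define G where "G = (\<lambda>\<omega>. iexp (\<Sum>k\<in>K. b k * Y k \<omega>))"
    have [measurable]: "G \<in> borel_measurable M" unfolding G_def by measurable
    have bG: "norm (G \<omega>) \<le> 1" for \<omega> by (simp add: G_def)
    have "(CLINT \<omega>|M. (G \<omega> - expectation G) * (\<Prod>j\<in>J. indicator (A j) (X j \<omega>))) = 0"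
    proof (rule expectation_prod_indicator_eq_0[OF fin(1)])
      show "norm (G \<omega> - expectation G) \<le> 2" for \<omega>
        using norm_triangle_ineq4[of "G \<omega>" "expectation G"] bG[of \<omega>] nE[of G, OF _ bG]
        by simp
    next
      fix a
      let ?F = "\<lambda>\<omega>. iexp (\<Sum>j\<in>J. a j * X j \<omega>)"
      have "(CLINT \<omega>|M. (G \<omega> - expectation G) * ?F \<omega>) =
          (CLINT \<omega>|M. ?F \<omega> * G \<omega> - expectation G * ?F \<omega>)"
        by (simp add: algebra_simps)
      also have "\<dots> = (CLINT \<omega>|M. ?F \<omega> * G \<omega>) - (CLINT \<omega>|M. expectation G * ?F \<omega>)"
        using bG by (intro Bochner_Integration.integral_diff integrable_mult_right intb)
          (auto simp: norm_mult simp del: of_real_sum)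
      also have "\<dots> = 0"
        unfolding integral_mult_right_zero using char[of a b]
        by (simp add: G_def mult.commute del: of_real_sum)
      finally show "(CLINT \<omega>|M. (G \<omega> - expectation G) * ?F \<omega>) = 0" .
    qed (auto simp: meas sets)
    also have "(CLINT \<omega>|M. (G \<omega> - expectation G) * (\<Prod>j\<in>J. indicator (A j) (X j \<omega>))) =
        (CLINT \<omega>|M. P \<omega> * G \<omega> - expectation G * P \<omega>)"
      by (intro Bochner_Integration.integral_cong) (simp_all add: P algebra_simps)
    also have "\<dots> = (CLINT \<omega>|M. P \<omega> * G \<omega>) - (CLINT \<omega>|M. expectation G * P \<omega>)"
      using bP bG mult_mono[OF bP bG] by (intro Bochner_Integration.integral_diff integrable_mult_right intb)
          (auto simp: norm_mult)
    finally show ?thesis by (simp add: G_def mult.commute)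
  qed
  have "(CLINT \<omega>|M. (P \<omega> - expectation P) * (\<Prod>k\<in>K. indicator (B k) (Y k \<omega>))) = 0"
  proof (rule expectation_prod_indicator_eq_0[OF fin(2)])
    show "norm (P \<omega> - expectation P) \<le> 2" for \<omega>
      using norm_triangle_ineq4[of "P \<omega>" "expectation P"] bP[of \<omega>] nE[of P, OF _ bP]
        by simp
  next
    fix b
    let ?G = "\<lambda>\<omega>. iexp (\<Sum>k\<in>K. b k * Y k \<omega>)"
    have "(CLINT \<omega>|M. (P \<omega> - expectation P) * ?G \<omega>) =
        (CLINT \<omega>|M. P \<omega> * ?G \<omega> - expectation P * ?G \<omega>)"
      by (simp add: algebra_simps)
    also have "\<dots> = (CLINT \<omega>|M. P \<omega> * ?G \<omega>) - (CLINT \<omega>|M. expectation P * ?G \<omega>)"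
      using bP by (intro Bochner_Integration.integral_diff integrable_mult_right intb)
        (auto simp: norm_mult simp del: of_real_sum)
    also have "\<dots> = 0"
      unfolding integral_mult_right_zero step1 by simp
    finally show "(CLINT \<omega>|M. (P \<omega> - expectation P) * ?G \<omega>) = 0" .
  qed (auto simp: meas sets)
  also have "(CLINT \<omega>|M. (P \<omega> - expectation P) * (\<Prod>k\<in>K. indicator (B k) (Y k \<omega>))) =
      (CLINT \<omega>|M. P \<omega> * Q \<omega> - expectation P * Q \<omega>)"
    by (intro Bochner_Integration.integral_cong) (simp_all add: Q algebra_simps)
  also have "\<dots> = (CLINT \<omega>|M. P \<omega> * Q \<omega>) - (CLINT \<omega>|M. expectation P * Q \<omega>)"
    using bP bQ mult_mono[OF bP bQ] by (intro Bochner_Integration.integral_diff integrable_mult_right intb)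
        (auto simp: norm_mult)
  finally have eq: "(CLINT \<omega>|M. P \<omega> * Q \<omega>) = expectation P * expectation Q" by simp
  have PQ: "(\<lambda>\<omega>. P \<omega> * Q \<omega>) = indicator (EA \<inter> EB)"
    by (auto simp: P_def Q_def indicator_def)
  have ind: "expectation (indicator E :: 'a \<Rightarrow> complex) = complex_of_real (prob E)" if "E \<in> events" for E
  proof -
    have "(indicator E :: 'a \<Rightarrow> complex) = (\<lambda>\<omega>. complex_of_real (indicator E \<omega>))"
      by (auto simp: indicator_def)
    then show ?thesis using that sets.sets_into_space[OF that] by (simp add: Int_absorb2)
  qed
  have "complex_of_real (prob (EA \<inter> EB)) = complex_of_real (prob EA * prob EB)"
    using eq unfolding PQ by (simp add: P_def Q_def ind del: integral_indicator)
  then show ?thesis unfolding EA_def EB_def by (simp only: of_real_eq_iff)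
qed

text \<open>
  Cylinders with finite-dimensional base form an intersection-stable generator of the product
  \<open>\<sigma>\<close>-algebra on paths, so independence needs to be checked on them only.
\<close>

lemma independent_processes_of_char:
  fixes X Y :: "real \<Rightarrow> 'a \<Rightarrow> real"
  assumes meas: "\<And>t. t \<in> T \<Longrightarrow> X t \<in> borel_measurable M" "\<And>t. t \<in> T \<Longrightarrow> Y t \<in> borel_measurable M"
    and char: "\<And>J K a b. finite J \<Longrightarrow> J \<subseteq> T \<Longrightarrow> finite K \<Longrightarrow> K \<subseteq> T \<Longrightarrow>
      (CLINT \<omega>|M. iexp (\<Sum>j\<in>J. a j * X j \<omega>) * iexp (\<Sum>k\<in>K. b k * Y k \<omega>)) =
      (CLINT \<omega>|M. iexp (\<Sum>j\<in>J. a j * X j \<omega>)) * (CLINT \<omega>|M. iexp (\<Sum>k\<in>K. b k * Y k \<omega>))"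
  shows "independent_processes M T X Y"
proof -
  let ?S = "PiM T (\<lambda>_. borel :: real measure)"
  let ?path = "\<lambda>X \<omega>. \<lambda>t\<in>T. X t \<omega> :: real"
  let ?G = "\<lambda>X. {?path X -` E \<inter> space M | E. E \<in> prod_algebra T (\<lambda>_. borel :: real measure)}"
  have rv: "?path X \<in> measurable M ?S" "?path Y \<in> measurable M ?S"
    using meas by (auto intro!: measurable_restrict)
  have gen: "{?path X -` A \<inter> space M | A. A \<in> sets ?S} = sigma_sets (space M) (?G X)" for X
    unfolding sets_PiM
    by (rule sigma_sets_vimage_commute) (auto simp: space_borel)
  have stable: "Int_stable (?G X)" for X
  proof (rule Int_stableI)
    fix a b assume "a \<in> ?G X" "b \<in> ?G X"
    then obtain A B where AB: "A \<in> prod_algebra T (\<lambda>_. borel)" "B \<in> prod_algebra T (\<lambda>_. borel)"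
        "a = ?path X -` A \<inter> space M" "b = ?path X -` B \<inter> space M" by auto
    then have "a \<inter> b = ?path X -` (A \<inter> B) \<inter> space M" by auto
    moreover have "A \<inter> B \<in> prod_algebra T (\<lambda>_. borel)"
      using Int_stableD[OF Int_stable_prod_algebra AB(1,2)] .
    ultimately show "a \<inter> b \<in> ?G X" by blast
  qed
  have cyl: "\<exists>J E. finite J \<and> J \<subseteq> T \<and> (\<forall>j\<in>J. E j \<in> sets borel) \<and>
      a = {\<omega>\<in>space M. \<forall>j\<in>J. X j \<omega> \<in> E j}" if mem: "a \<in> ?G X" for a X
  proof -
    obtain A where A: "A \<in> prod_algebra T (\<lambda>_. borel)" "a = ?path X -` A \<inter> space M"
      using mem by auto
    obtain J E where JE: "A = prod_emb T (\<lambda>_. borel) J (Pi\<^sub>E J E)" "finite J" "J \<subseteq> T"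
        "\<And>j. j \<in> J \<Longrightarrow> E j \<in> sets borel"
      using A(1) by (elim prod_algebraE) blast
    have "a = {\<omega>\<in>space M. \<forall>j\<in>J. X j \<omega> \<in> E j}"
      unfolding A(2) JE(1) using JE(3) by (auto simp: prod_emb_def PiE_iff subset_eq)
    with JE show ?thesis by blast
  qed
  have "indep_set (?G X) (?G Y)"
  proof (rule indep_setI)
    show "?G X \<subseteq> events" "?G Y \<subseteq> events"
      using measurable_sets[OF rv(1)] measurable_sets[OF rv(2)] sets_PiM[of T "\<lambda>_. borel :: real measure"]
      by auto
    fix a b assume "a \<in> ?G X" "b \<in> ?G Y"
    obtain J E where J: "finite J" "J \<subseteq> T" "\<And>j. j \<in> J \<Longrightarrow> E j \<in> sets borel"
        "a = {\<omega>\<in>space M. \<forall>j\<in>J. X j \<omega> \<in> E j}"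
      using cyl[OF \<open>a \<in> ?G X\<close>] by blast
    obtain K F where K: "finite K" "K \<subseteq> T" "\<And>j. j \<in> K \<Longrightarrow> F j \<in> sets borel"
        "b = {\<omega>\<in>space M. \<forall>j\<in>K. Y j \<omega> \<in> F j}"
      using cyl[OF \<open>b \<in> ?G Y\<close>] by blast
    show "prob (a \<inter> b) = prob a * prob b"
      unfolding J(4) K(4)
      by (rule prob_cylinders_of_char)
        (use J K meas in \<open>auto intro!: char simp del: of_real_sum\<close>)
  qed
  then have "indep_set (sigma_sets (space M) (?G X)) (sigma_sets (space M) (?G Y))"
    by (rule indep_set_sigma_sets[OF _ stable stable])
  moreover have "sigma_sets (space M) (sigma_sets (space M) (?G X)) = sigma_sets (space M) (?G X)" for X
    by (rule sigma_sets_sigma_sets_eq) auto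
  ultimately show ?thesis
    unfolding independent_processes_def indep_var_eq gen using rv by (simp only:)
qed

end

section \<open>Integrals of step functions\<close>

text \<open>
  The squared norm in \<open>L\<^sup>2([0,1])\<close>; by the isometry it is the variance of the Wiener integral of \<open>f\<close>.
\<close>

definition square_integral :: "(real \<Rightarrow> real) \<Rightarrow> real" where
  "square_integral f = (LBINT u:{0..1}. (f u)\<^sup>2)"

text \<open>
  The identity is linear in the increments of an arbitrary \<open>F\<close>. Taking a path of \<open>W\<close> for \<open>F\<close> gives the
  integral of the step function, and taking \<open>\<lambda>x. indicator {..x} u\<close> gives its value at \<open>u\<close>, so one
  refinement serves both with the same coefficients \<open>d\<close>.
\<close>

lemma step_sum_refine:
  fixes t :: "nat \<Rightarrow> real"
  assumes "\<And>c a b. (c, a, b) \<in> set \<phi> \<Longrightarrow> \<exists>p q. p \<le> q \<and> q \<le> m \<and> a = t p \<and> b = t q"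
  shows "\<exists>d. \<forall>F::real \<Rightarrow> real. (\<Sum>(c, a, b)\<leftarrow>\<phi>. c * (F b - F a)) =
    (\<Sum>i<m. d i * (F (t (Suc i)) - F (t i)))"
  using assms
proof (induction \<phi>)
  case Nil
  show ?case by (intro exI[of _ "\<lambda>_. 0"]) simp
next
  case (Cons x \<phi>)
  obtain c a b where x: "x = (c, a, b)" by (cases x)
  obtain p q where pq: "p \<le> q" "q \<le> m" "a = t p" "b = t q"
    using Cons.prems[of c a b] x by auto
  obtain d where d: "\<And>F::real \<Rightarrow> real. (\<Sum>(c, a, b)\<leftarrow>\<phi>. c * (F b - F a)) =
    (\<Sum>i<m. d i * (F (t (Suc i)) - F (t i)))"
  proof -
    have "\<exists>d. \<forall>F::real \<Rightarrow> real. (\<Sum>(c, a, b)\<leftarrow>\<phi>. c * (F b - F a)) =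
        (\<Sum>i<m. d i * (F (t (Suc i)) - F (t i)))"
      by (rule Cons.IH, rule Cons.prems, rule list.set_intros(2))
    then show thesis using that by blast
  qed
  let ?d = "\<lambda>i. d i + (if i \<in> {p..<q} then c else 0)"
  show ?case
  proof (intro exI[of _ ?d] allI)
    fix F :: "real \<Rightarrow> real"
    have "(\<Sum>i<m. (if i \<in> {p..<q} then c else 0) * (F (t (Suc i)) - F (t i))) =
        (\<Sum>i<m. if i \<in> {p..<q} then c * (F (t (Suc i)) - F (t i)) else 0)"
      by (intro sum.cong) auto
    also have "\<dots> = (\<Sum>i\<in>{..<m} \<inter> {p..<q}. c * (F (t (Suc i)) - F (t i)))"
      by (rule sum.inter_restrict[symmetric]) simp
    also have "{..<m} \<inter> {p..<q} = {p..<q}" using pq(2) by auto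
    also have "(\<Sum>i\<in>{p..<q}. c * (F (t (Suc i)) - F (t i))) = c * (F b - F a)"
      using sum_Suc_diff'[OF pq(1), of "\<lambda>i. F (t i)"] pq(3,4) by (simp add: sum_distrib_left[symmetric])
    finally show "(\<Sum>(c, a, b)\<leftarrow>x # \<phi>. c * (F b - F a)) =
        (\<Sum>i<m. ?d i * (F (t (Suc i)) - F (t i)))"
      by (simp only: distrib_right sum.distrib d[symmetric] x list.map sum_list.Cons prod.case add.commute)
  qed
qed

text \<open>
  The partition consists of all end points of the intervals in sorted order. The point \<open>0\<close> is added
  to them because \<open>\<phi>\<close> may be the empty list.
\<close>

lemma step_common_refinement:
  assumes "step01 \<phi>"
  obtains m :: nat and t d :: "nat \<Rightarrow> real" where
    "0 \<le> t 0" "\<And>i j. i < j \<Longrightarrow> j \<le> m \<Longrightarrow> t i < t j" "t m \<le> 1"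
    "\<And>F::real \<Rightarrow> real. (\<Sum>(c, a, b)\<leftarrow>\<phi>. c * (F b - F a)) =
      (\<Sum>i<m. d i * (F (t (Suc i)) - F (t i)))"
proof -
  define P where "P = insert 0 (\<Union>(c, a, b)\<in>set \<phi>. {a, b})"
  have fin: "finite P" unfolding P_def by auto
  have sub: "P \<subseteq> {0..1}" using assms unfolding P_def step01_def by fastforce
  define ts where "ts = sorted_list_of_set P"
  have set_ts: "set ts = P" and sorted_ts: "sorted_wrt (<) ts"
    using fin by (simp_all add: ts_def strict_sorted_iff)
  define m where "m = length ts - 1"
  have "ts \<noteq> []" using set_ts by (auto simp: P_def)
  then have len: "length ts = Suc m" by (cases ts) (auto simp: m_def)
  have mono: "ts ! i < ts ! j" if "i < j" "j \<le> m" for i j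
    using sorted_wrt_nth_less[OF sorted_ts, of i j] that len by simp
  have in01: "ts ! i \<in> {0..1}" if "i \<le> m" for i
    using that len set_ts sub nth_mem[of i ts] by auto
  have idx: "\<exists>p\<le>m. a = ts ! p" if "a \<in> P" for a
    using that set_ts len by (metis in_set_conv_nth less_Suc_eq_le)
  have "\<exists>d. \<forall>F::real \<Rightarrow> real. (\<Sum>(c, a, b)\<leftarrow>\<phi>. c * (F b - F a)) =
    (\<Sum>i<m. d i * (F (ts ! Suc i) - F (ts ! i)))"
  proof (rule step_sum_refine)
    fix c a b assume mem: "(c, a, b) \<in> set \<phi>"
    then have "a \<in> P" "b \<in> P" by (auto simp: P_def)
    then obtain p q where pq: "p \<le> m" "a = ts ! p" "q \<le> m" "b = ts ! q" using idx by blast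
    have "a \<le> b" using assms mem by (auto simp: step01_def)
    then have "p \<le> q" using mono[of q p] pq by (auto simp: not_less[symmetric])
    then show "\<exists>p q. p \<le> q \<and> q \<le> m \<and> a = ts ! p \<and> b = ts ! q" using pq by blast
  qed
  then obtain d where "\<And>F::real \<Rightarrow> real. (\<Sum>(c, a, b)\<leftarrow>\<phi>. c * (F b - F a)) =
    (\<Sum>i<m. d i * (F (ts ! Suc i) - F (ts ! i)))" by blast
  then show thesis
    using that[of "\<lambda>i. ts ! i" m d] mono in01[of 0] in01[of m] by auto
qed

lemma step_fun_eq_increments:
  assumes "step01 \<phi>"
  shows "step_fun \<phi> u = (\<Sum>(c, a, b)\<leftarrow>\<phi>. c * (indicator {..b} u - indicator {..a} u))"
proof -
  have "(\<lambda>(c, a, b). c * indicator {a<..b} u) x =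
      (\<lambda>(c, a, b). c * (indicator {..b} u - indicator {..a} u) :: real) x"
    if "x \<in> set \<phi>" for x
    using assms that by (auto simp: step01_def indicator_def split: prod.splits)
  then have "map (\<lambda>(c, a, b). c * indicator {a<..b} u) \<phi> =
      map (\<lambda>(c, a, b). c * (indicator {..b} u - indicator {..a} u) :: real) \<phi>"
    by (rule map_cong[OF refl])
  then show ?thesis unfolding step_fun_def by (rule arg_cong[where f=sum_list])
qed

text \<open>
  Cross terms vanish because the intervals are disjoint.
\<close>

lemma square_sum_indicators:
  fixes t d :: "nat \<Rightarrow> real"
  assumes "\<And>i j. i < j \<Longrightarrow> j \<le> m \<Longrightarrow> t i < t j"
  shows "(\<Sum>i<m. d i * indicator {t i<..t (Suc i)} u)\<^sup>2 =
    (\<Sum>i<m. (d i)\<^sup>2 * indicator {t i<..t (Suc i)} u)"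
  using assms
proof (induction m)
  case 0
  then show ?case by simp
next
  case (Suc m)
  have IH: "(\<Sum>i<m. d i * indicator {t i<..t (Suc i)} u)\<^sup>2 =
    (\<Sum>i<m. (d i)\<^sup>2 * indicator {t i<..t (Suc i)} u)" using Suc by auto
  have "(\<Sum>i<m. d i * indicator {t i<..t (Suc i)} u) * indicator {t m<..t (Suc m)} u = 0"
  proof (cases "t m < u")
    case True
    have "\<not> u \<le> t (Suc i)" if "i < m" for i
    proof (cases "Suc i = m")
      case False
      then have "t (Suc i) < t m" using that by (intro Suc.prems) auto
      with True show ?thesis by simp
    qed (use True in simp)
    then have "(\<Sum>i<m. d i * indicator {t i<..t (Suc i)} u) = 0"
      by (intro sum.neutral) simp
    then show ?thesis by simp
  qed auto
  moreover have "(indicator {t m<..t (Suc m)} u :: real)\<^sup>2 = indicator {t m<..t (Suc m)} u"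
    by (auto simp: indicator_def)
  moreover have "(S + c * I)\<^sup>2 = S\<^sup>2 + c\<^sup>2 * I" if "S * I = 0" "I\<^sup>2 = I" for S I c :: real
    using that by (auto simp: power_mult_distrib)
  ultimately show ?case unfolding sum.lessThan_Suc IH[symmetric] by blast
qed

lemma square_integral_increments:
  fixes t d :: "nat \<Rightarrow> real"
  assumes "0 \<le> t 0" and mono: "\<And>i j. i < j \<Longrightarrow> j \<le> m \<Longrightarrow> t i < t j" and "t m \<le> 1"
  shows "square_integral (\<lambda>u. \<Sum>i<m. d i * indicator {t i<..t (Suc i)} u) =
    (\<Sum>i<m. (d i)\<^sup>2 * (t (Suc i) - t i))"
proof -
  have le: "t i \<le> t j" if "i \<le> j" "j \<le> m" for i j
    using mono[of i j] that by (cases "i = j") auto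
  have sub: "{t i<..t (Suc i)} \<subseteq> {0..1}" if "i < m" for i
    using le[of 0 i] le[of "Suc i" m] assms that by auto
  have sq: "(\<Sum>i<m. d i * indicator {t i<..t (Suc i)} u)\<^sup>2 =
      (\<Sum>i<m. (d i)\<^sup>2 * indicator {t i<..t (Suc i)} u)" for u
    by (rule square_sum_indicators) (rule mono)
  have "square_integral (\<lambda>u. \<Sum>i<m. d i * indicator {t i<..t (Suc i)} u) =
      (LBINT u. \<Sum>i<m. (d i)\<^sup>2 * indicator {t i<..t (Suc i)} u)"
    unfolding square_integral_def set_lebesgue_integral_def sq
  proof (rule Bochner_Integration.integral_cong[OF refl])
    fix u
    show "indicator {0..1} u *\<^sub>R (\<Sum>i<m. (d i)\<^sup>2 * indicator {t i<..t (Suc i)} u) =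
        (\<Sum>i<m. (d i)\<^sup>2 * indicator {t i<..t (Suc i)} u)"
    proof (cases "u \<in> {0..1}")
      case False
      then have "u \<notin> {t i<..t (Suc i)}" if "i < m" for i using sub[OF that] by blast
      then have "(\<Sum>i<m. (d i)\<^sup>2 * indicator {t i<..t (Suc i)} u) = 0"
        by (intro sum.neutral) simp
      then show ?thesis by simp
    qed simp
  qed
  also have "\<dots> = (\<Sum>i<m. (d i)\<^sup>2 * (t (Suc i) - t i))"
    by (subst Bochner_Integration.integral_sum) (auto simp: le)
  finally show ?thesis .
qed

context prob_space
begin

lemma centered_normal_sum_indep:
  assumes indep: "indep_vars (\<lambda>_. borel) X A" and "finite A"
    and normal: "\<And>i. i \<in> A \<Longrightarrow> centered_normal M (v i) (X i)"
  shows "centered_normal M (\<Sum>i\<in>A. (d i)\<^sup>2 * v i) (\<lambda>\<omega>. \<Sum>i\<in>A. d i * X i \<omega>)"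
proof -
  have X[measurable]: "X i \<in> borel_measurable M" if "i \<in> A" for i
    using normal[OF that] by (simp add: centered_normal_def)
  have S[measurable]: "(\<lambda>\<omega>. \<Sum>i\<in>A. d i * X i \<omega>) \<in> borel_measurable M" by measurable
  have indep': "indep_vars (\<lambda>_. borel) (\<lambda>i \<omega>. d i * X i \<omega>) A"
    by (rule indep_vars_compose2[OF indep, where Y="\<lambda>i x. d i * x"]) simp
  have "(CLINT \<omega>|M. iexp (s * (\<Sum>i\<in>A. d i * X i \<omega>))) =
      exp (- ((\<Sum>i\<in>A. (d i)\<^sup>2 * v i) * s\<^sup>2) / 2)" for s
  proof -
    have "(CLINT \<omega>|M. iexp (s * (\<Sum>i\<in>A. d i * X i \<omega>))) =
        (\<Prod>i\<in>A. char (distr M borel (\<lambda>\<omega>. d i * X i \<omega>)) s)"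
      using char_distr_sum[OF indep', of s] char_distr_eq[OF S, of s] by simp
    also have "\<dots> = (\<Prod>i\<in>A. complex_of_real (exp (- (((d i)\<^sup>2 * v i) * s\<^sup>2) / 2)))"
    proof (rule prod.cong[OF refl])
      fix i assume i: "i \<in> A"
      have "char (distr M borel (\<lambda>\<omega>. d i * X i \<omega>)) s = (CLINT \<omega>|M. iexp ((s * d i) * X i \<omega>))"
        using X[OF i] by (subst char_distr_eq) (simp_all add: mult.assoc)
      also have "\<dots> = exp (- (v i * (s * d i)\<^sup>2) / 2)"
        using normal[OF i] unfolding centered_normal_def by blast
      finally show "char (distr M borel (\<lambda>\<omega>. d i * X i \<omega>)) s =
          complex_of_real (exp (- (((d i)\<^sup>2 * v i) * s\<^sup>2) / 2))"
        by (simp add: power_mult_distrib mult_ac)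
    qed
    also have "\<dots> = exp (\<Sum>i\<in>A. - (((d i)\<^sup>2 * v i) * s\<^sup>2) / 2)"
      using \<open>finite A\<close> by (simp add: exp_sum)
    also have "(\<Sum>i\<in>A. - (((d i)\<^sup>2 * v i) * s\<^sup>2) / 2) = - ((\<Sum>i\<in>A. (d i)\<^sup>2 * v i) * s\<^sup>2) / 2"
      by (simp add: sum_distrib_right sum_divide_distrib sum_negf)
    finally show ?thesis .
  qed
  moreover have "0 \<le> v i" if "i \<in> A" for i
    using normal[OF that] by (simp add: centered_normal_def)
  ultimately show ?thesis unfolding centered_normal_def by (auto intro!: sum_nonneg)
qed

text \<open>
  Along a common refinement the integral is a linear combination of independent centered normal
  increments, whose variances are the lengths of the intervals.
\<close>

lemma step_integral_centered_normal:
  assumes W: "standard_brownian_motion M W" and \<phi>: "step01 \<phi>"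
  shows "centered_normal M (square_integral (step_fun \<phi>)) (step_integral W \<phi>)"
proof -
  obtain m t d where t: "0 \<le> t 0" "\<And>i j. i < j \<Longrightarrow> j \<le> m \<Longrightarrow> t i < t j" "t m \<le> 1"
    and eq: "\<And>F::real \<Rightarrow> real. (\<Sum>(c, a, b)\<leftarrow>\<phi>. c * (F b - F a)) =
      (\<Sum>i<m. d i * (F (t (Suc i)) - F (t i)))"
    by (rule step_common_refinement[OF \<phi>]) (use that in blast)
  have le: "t i \<le> t j" if "i \<le> j" "j \<le> m" for i j
    using t(2)[of i j] that by (cases "i = j") auto
  have sf: "step_fun \<phi> = (\<lambda>u. \<Sum>i<m. d i * indicator {t i<..t (Suc i)} u)"
  proof
    fix u
    have "step_fun \<phi> u = (\<Sum>i<m. d i * (indicator {..t (Suc i)} u - indicator {..t i} u))"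
      unfolding step_fun_eq_increments[OF \<phi>] by (rule eq)
    also have "\<dots> = (\<Sum>i<m. d i * indicator {t i<..t (Suc i)} u)"
    proof (rule sum.cong[OF refl])
      fix i assume "i \<in> {..<m}"
      then have "t i < t (Suc i)" by (intro t(2)) auto
      then show "d i * (indicator {..t (Suc i)} u - indicator {..t i} u) =
          d i * indicator {t i<..t (Suc i)} u"
        by (auto simp: indicator_def)
    qed
    finally show "step_fun \<phi> u = (\<Sum>i<m. d i * indicator {t i<..t (Suc i)} u)" .
  qed
  have si: "step_integral W \<phi> = (\<lambda>\<omega>. \<Sum>i<m. d i * (W (t (Suc i)) \<omega> - W (t i) \<omega>))"
    unfolding step_integral_def by (rule ext, rule eq)
  have "indep_vars (\<lambda>_. borel) (\<lambda>i \<omega>. W (t (Suc i)) \<omega> - W (t i) \<omega>) {..<m}"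
  proof -
    have "0 \<le> t 0 \<and> (\<forall>i<m. t i \<le> t (Suc i)) \<and> t m \<le> 1"
      using t(1,3) le[of i "Suc i" for i] by simp
    with W show ?thesis unfolding standard_brownian_motion_def by blast
  qed
  moreover have "centered_normal M (t (Suc i) - t i) (\<lambda>\<omega>. W (t (Suc i)) \<omega> - W (t i) \<omega>)"
    if "i < m" for i
  proof -
    have i: "0 \<le> t i" "t i < t (Suc i)" "t (Suc i) \<le> 1"
      using that t le[of 0 i] le[of "Suc i" m] by auto
    then have "distributed M lborel (\<lambda>\<omega>. W (t (Suc i)) \<omega> - W (t i) \<omega>)
        (normal_density 0 (sqrt (t (Suc i) - t i)))"
      using W unfolding standard_brownian_motion_def by blast
    from centered_normal_of_distributed[OF _ this] i show ?thesis by simp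
  qed
  ultimately have "centered_normal M (\<Sum>i<m. (d i)\<^sup>2 * (t (Suc i) - t i)) (step_integral W \<phi>)"
    unfolding si by (intro centered_normal_sum_indep) auto
  moreover have "square_integral (step_fun \<phi>) = (\<Sum>i<m. (d i)\<^sup>2 * (t (Suc i) - t i))"
    unfolding sf by (rule square_integral_increments) (use t in auto)
  ultimately show ?thesis by simp
qed

end

section \<open>Convergence in \<open>L\<^sup>2\<close>\<close>

definition L2_tendsto :: "'b measure \<Rightarrow> (nat \<Rightarrow> 'b \<Rightarrow> real) \<Rightarrow> ('b \<Rightarrow> real) \<Rightarrow> bool" where
  "L2_tendsto N F f \<longleftrightarrow> (\<forall>m. F m \<in> borel_measurable N) \<and> f \<in> borel_measurable N \<and>
     (\<lambda>m. \<integral>\<^sup>+x. ennreal ((F m x - f x)\<^sup>2) \<partial>N) \<longlonglongrightarrow> 0"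

lemma L2_tendsto_add:
  assumes F: "L2_tendsto N F f" and G: "L2_tendsto N G g"
  shows "L2_tendsto N (\<lambda>m x. F m x + G m x) (\<lambda>x. f x + g x)"
proof -
  have [measurable]: "\<And>m. F m \<in> borel_measurable N" "f \<in> borel_measurable N"
    "\<And>m. G m \<in> borel_measurable N" "g \<in> borel_measurable N"
    using F G by (auto simp: L2_tendsto_def)
  let ?u = "\<lambda>m. 2 * (\<integral>\<^sup>+x. ennreal ((F m x - f x)\<^sup>2) \<partial>N) + 2 * (\<integral>\<^sup>+x. ennreal ((G m x - g x)\<^sup>2) \<partial>N)"
  have "(\<lambda>m. \<integral>\<^sup>+x. ennreal ((F m x + G m x - (f x + g x))\<^sup>2) \<partial>N) \<longlonglongrightarrow> 0"
  proof (rule tendsto_sandwich[of "\<lambda>_. 0" _ _ ?u])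
    have "?u \<longlonglongrightarrow> 2 * 0 + 2 * 0"
      using F G unfolding L2_tendsto_def by (intro tendsto_add ennreal_tendsto_cmult) auto
    then show "?u \<longlonglongrightarrow> 0" by simp
    show "\<forall>\<^sub>F m in sequentially. (\<integral>\<^sup>+x. ennreal ((F m x + G m x - (f x + g x))\<^sup>2) \<partial>N) \<le> ?u m"
    proof (intro always_eventually allI)
      fix m
      have "(a + b - (c + d))\<^sup>2 \<le> 2 * (a - c)\<^sup>2 + 2 * (b - d)\<^sup>2" for a b c d :: real
        using zero_le_power2[of "(a - c) - (b - d)"] by (simp add: power2_eq_square algebra_simps)
      then have "ennreal ((a + b - (c + d))\<^sup>2) \<le> ennreal (2 * (a - c)\<^sup>2 + 2 * (b - d)\<^sup>2)"
        for a b c d :: real by (rule ennreal_leI)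
      then have "ennreal ((a + b - (c + d))\<^sup>2) \<le> 2 * ennreal ((a - c)\<^sup>2) + 2 * ennreal ((b - d)\<^sup>2)"
        for a b c d :: real by (simp add: ennreal_plus ennreal_mult')
      then have "(\<integral>\<^sup>+x. ennreal ((F m x + G m x - (f x + g x))\<^sup>2) \<partial>N) \<le>
          (\<integral>\<^sup>+x. 2 * ennreal ((F m x - f x)\<^sup>2) + 2 * ennreal ((G m x - g x)\<^sup>2) \<partial>N)"
        by (intro nn_integral_mono)
      also have "\<dots> = ?u m"
        by (simp add: nn_integral_add nn_integral_cmult)
      finally show "(\<integral>\<^sup>+x. ennreal ((F m x + G m x - (f x + g x))\<^sup>2) \<partial>N) \<le> ?u m" .
    qed
  qed auto
  then show ?thesis by (simp add: L2_tendsto_def)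
qed

lemma L2_tendsto_cmult:
  assumes F: "L2_tendsto N F f"
  shows "L2_tendsto N (\<lambda>m x. c * F m x) (\<lambda>x. c * f x)"
proof -
  have [measurable]: "\<And>m. F m \<in> borel_measurable N" "f \<in> borel_measurable N"
    using F by (auto simp: L2_tendsto_def)
  have "(\<integral>\<^sup>+x. ennreal ((c * F m x - c * f x)\<^sup>2) \<partial>N) =
      ennreal (c\<^sup>2) * (\<integral>\<^sup>+x. ennreal ((F m x - f x)\<^sup>2) \<partial>N)" for m
    by (simp add: nn_integral_cmult[symmetric] power_mult_distrib
        flip: right_diff_distrib ennreal_mult)
  moreover have "(\<lambda>m. ennreal (c\<^sup>2) * (\<integral>\<^sup>+x. ennreal ((F m x - f x)\<^sup>2) \<partial>N)) \<longlonglongrightarrow> ennreal (c\<^sup>2) * 0"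
    using F unfolding L2_tendsto_def by (intro ennreal_tendsto_cmult) auto
  ultimately show ?thesis by (simp add: L2_tendsto_def)
qed

lemma L2_tendsto_cong_AE:
  assumes F: "L2_tendsto N F f" and "AE x in N. f x = g x" "g \<in> borel_measurable N"
  shows "L2_tendsto N F g"
proof -
  have "(\<integral>\<^sup>+x. ennreal ((F m x - f x)\<^sup>2) \<partial>N) = (\<integral>\<^sup>+x. ennreal ((F m x - g x)\<^sup>2) \<partial>N)" for m
    by (rule nn_integral_cong_AE) (use assms(2) in auto)
  with F assms(3) show ?thesis by (simp add: L2_tendsto_def)
qed

lemma L2_tendsto_real:
  assumes "L2_tendsto N F f"
  shows "\<forall>\<^sub>F m in sequentially. integrable N (\<lambda>x. (F m x - f x)\<^sup>2)"
    and "(\<lambda>m. LINT x|N. (F m x - f x)\<^sup>2) \<longlonglongrightarrow> 0"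
proof -
  have [measurable]: "\<And>m. F m \<in> borel_measurable N" "f \<in> borel_measurable N"
    and lim: "(\<lambda>m. \<integral>\<^sup>+x. ennreal ((F m x - f x)\<^sup>2) \<partial>N) \<longlonglongrightarrow> 0"
    using assms by (auto simp: L2_tendsto_def)
  have "\<forall>\<^sub>F m in sequentially. (\<integral>\<^sup>+x. ennreal ((F m x - f x)\<^sup>2) \<partial>N) < \<infinity>"
    using order_tendstoD(2)[OF lim, of \<infinity>] by simp
  then show ev: "\<forall>\<^sub>F m in sequentially. integrable N (\<lambda>x. (F m x - f x)\<^sup>2)"
    by eventually_elim (simp add: integrable_iff_bounded)
  have "(\<lambda>m. enn2real (\<integral>\<^sup>+x. ennreal ((F m x - f x)\<^sup>2) \<partial>N)) \<longlonglongrightarrow> 0"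
    using lim by (intro tendsto_enn2real) auto
  then show "(\<lambda>m. LINT x|N. (F m x - f x)\<^sup>2) \<longlonglongrightarrow> 0"
    by (simp add: integral_eq_nn_integral)
qed

text \<open>
  Young's inequality for the mixed term of \<open>x\<^sup>2 - y\<^sup>2 = (x - y)\<^sup>2 + 2 y (x - y)\<close>. It gives convergence of
  norms in \<open>L\<^sup>2\<close> without the triangle inequality there.
\<close>

lemma square_diff_bound:
  fixes x y e :: real
  assumes "0 < e"
  shows "\<bar>x\<^sup>2 - y\<^sup>2\<bar> \<le> (1 + 1 / e) * (x - y)\<^sup>2 + e * y\<^sup>2"
proof -
  have eq: "x\<^sup>2 - y\<^sup>2 = (x - y)\<^sup>2 + 2 * y * (x - y)"
    by (simp add: power2_eq_square algebra_simps)
  have "\<bar>2 * y * (x - y)\<bar> \<le> e * y\<^sup>2 + (x - y)\<^sup>2 / e"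
  proof -
    have "0 \<le> (e * \<bar>y\<bar> - \<bar>x - y\<bar>)\<^sup>2" by simp
    also have "\<dots> = e * (e * y\<^sup>2) + (x - y)\<^sup>2 - e * \<bar>2 * y * (x - y)\<bar>"
      by (simp add: power2_diff power_mult_distrib abs_mult) (simp add: power2_eq_square)
    finally have "e * \<bar>2 * y * (x - y)\<bar> \<le> e * (e * y\<^sup>2 + (x - y)\<^sup>2 / e)"
      using assms by (simp add: distrib_left)
    then show ?thesis using assms by (simp only: mult_le_cancel_left_pos)
  qed
  moreover have "\<bar>x\<^sup>2 - y\<^sup>2\<bar> \<le> (x - y)\<^sup>2 + \<bar>2 * y * (x - y)\<bar>"
    unfolding eq by (rule order_trans[OF abs_triangle_ineq]) simp
  ultimately show ?thesis by (simp add: distrib_right)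
qed

lemma L2_tendsto_norm:
  assumes lim: "L2_tendsto N F f" and int: "\<And>m. integrable N (\<lambda>x. (F m x)\<^sup>2)"
  shows "integrable N (\<lambda>x. (f x)\<^sup>2)"
    and "(\<lambda>m. LINT x|N. (F m x)\<^sup>2) \<longlonglongrightarrow> (LINT x|N. (f x)\<^sup>2)"
proof -
  have [measurable]: "\<And>m. F m \<in> borel_measurable N" "f \<in> borel_measurable N"
    using lim by (auto simp: L2_tendsto_def)
  note ev = L2_tendsto_real(1)[OF lim] and lim0 = L2_tendsto_real(2)[OF lim]
  obtain m where m: "integrable N (\<lambda>x. (F m x - f x)\<^sup>2)"
    using ev by (auto simp: eventually_sequentially)
  have bound: "(b::real)\<^sup>2 \<le> 2 * (a - b)\<^sup>2 + 2 * a\<^sup>2" for a b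
    using zero_le_power2[of "2 * a - b"] by (simp add: power2_eq_square algebra_simps)
  show int_f: "integrable N (\<lambda>x. (f x)\<^sup>2)"
  proof (rule Bochner_Integration.integrable_bound[of N "\<lambda>x. 2 * (F m x - f x)\<^sup>2 + 2 * (F m x)\<^sup>2"])
    show "integrable N (\<lambda>x. 2 * (F m x - f x)\<^sup>2 + 2 * (F m x)\<^sup>2)"
      using m int by simp
    have "norm ((f x)\<^sup>2) \<le> norm (2 * (F m x - f x)\<^sup>2 + 2 * (F m x)\<^sup>2)" for x
      using bound[of "f x" "F m x"] by simp
    then show "AE x in N. norm ((f x)\<^sup>2) \<le> norm (2 * (F m x - f x)\<^sup>2 + 2 * (F m x)\<^sup>2)"
      by simp
  qed measurable
  define a where "a = (LINT x|N. (f x)\<^sup>2)"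
  have "0 \<le> a" by (simp add: a_def)
  show "(\<lambda>m. LINT x|N. (F m x)\<^sup>2) \<longlonglongrightarrow> (LINT x|N. (f x)\<^sup>2)"
  proof (rule LIMSEQ_I, unfold eventually_sequentially[symmetric] a_def[symmetric] real_norm_def)
    fix r :: real assume "0 < r"
    \<comment> \<open>the weight of the error term \<open>e * a\<close>, chosen to stay below \<open>r / 2\<close> also when \<open>a = 0\<close>\<close>
    define e where "e = r / (2 * (a + 1))"
    have e: "0 < e" using \<open>0 < r\<close> \<open>0 \<le> a\<close> by (simp add: e_def)
    have ea: "e * a \<le> r / 2" using \<open>0 < r\<close> \<open>0 \<le> a\<close> by (simp add: e_def field_simps)
    have "(\<lambda>m. (1 + 1 / e) * (LINT x|N. (F m x - f x)\<^sup>2)) \<longlonglongrightarrow> (1 + 1 / e) * 0"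
      by (intro tendsto_mult tendsto_const lim0)
    then have "\<forall>\<^sub>F m in sequentially. (1 + 1 / e) * (LINT x|N. (F m x - f x)\<^sup>2) < r / 2"
      using \<open>0 < r\<close> by (intro order_tendstoD) auto
    with ev show "\<forall>\<^sub>F m in sequentially. \<bar>(LINT x|N. (F m x)\<^sup>2) - a\<bar> < r"
    proof eventually_elim
      fix m assume m: "integrable N (\<lambda>x. (F m x - f x)\<^sup>2)"
        "(1 + 1 / e) * (LINT x|N. (F m x - f x)\<^sup>2) < r / 2"
      have "\<bar>(LINT x|N. (F m x)\<^sup>2) - a\<bar> = \<bar>LINT x|N. (F m x)\<^sup>2 - (f x)\<^sup>2\<bar>"
        unfolding a_def using int int_f by simp
      also have "\<dots> \<le> (LINT x|N. \<bar>(F m x)\<^sup>2 - (f x)\<^sup>2\<bar>)"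
        by (rule integral_abs_bound)
      also have "\<dots> \<le> (LINT x|N. (1 + 1 / e) * (F m x - f x)\<^sup>2 + e * (f x)\<^sup>2)"
        using int int_f m(1) by (intro integral_mono square_diff_bound[OF e]) auto
      also have "\<dots> = (1 + 1 / e) * (LINT x|N. (F m x - f x)\<^sup>2) + e * a"
        unfolding a_def using int_f m(1) by (subst Bochner_Integration.integral_add) auto
      also have "\<dots> < r" using m(2) ea by linarith
      finally show "\<bar>(LINT x|N. (F m x)\<^sup>2) - a\<bar> < r" .
    qed
  qed
qed

text \<open>
  The variance of \<open>\<bar>D\<bar>\<close> is nonnegative.
\<close>

lemma (in prob_space) expectation_abs_le_sqrt:
  assumes "D \<in> borel_measurable M" "integrable M (\<lambda>\<omega>. (D \<omega> :: real)\<^sup>2)"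
  shows "integrable M D" "expectation (\<lambda>\<omega>. \<bar>D \<omega>\<bar>) \<le> sqrt (expectation (\<lambda>\<omega>. (D \<omega>)\<^sup>2))"
proof -
  show int: "integrable M D"
    using square_integrable_imp_integrable[OF assms] .
  have "variance (\<lambda>\<omega>. \<bar>D \<omega>\<bar>) = expectation (\<lambda>\<omega>. (D \<omega>)\<^sup>2) - (expectation (\<lambda>\<omega>. \<bar>D \<omega>\<bar>))\<^sup>2"
    using variance_eq[of "\<lambda>\<omega>. \<bar>D \<omega>\<bar>"] int assms(2) by simp
  then have "(expectation (\<lambda>\<omega>. \<bar>D \<omega>\<bar>))\<^sup>2 \<le> expectation (\<lambda>\<omega>. (D \<omega>)\<^sup>2)"
    using variance_positive[of "\<lambda>\<omega>. \<bar>D \<omega>\<bar>"] by simp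
  then show "expectation (\<lambda>\<omega>. \<bar>D \<omega>\<bar>) \<le> sqrt (expectation (\<lambda>\<omega>. (D \<omega>)\<^sup>2))"
    by (rule real_le_rsqrt)
qed

lemma iexp_diff_le: "norm (iexp a - iexp b) \<le> \<bar>a - b\<bar>"
proof -
  have "norm (iexp a - iexp b) = norm (iexp b * (iexp (a - b) - 1))"
    by (simp add: right_diff_distrib exp_add[symmetric] of_real_diff)
  also have "\<dots> = norm (iexp (a - b) - 1)" by (simp only: norm_mult norm_exp_i_times)
  also have "\<dots> \<le> \<bar>a - b\<bar>" using iexp_approx1[of "a - b" 0] by simp
  finally show ?thesis .
qed

text \<open>
  Convergence in \<open>L\<^sup>2\<close> implies convergence in \<open>L\<^sup>1\<close>, and \<open>iexp\<close> is Lipschitz with constant 1.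
\<close>

lemma (in prob_space) L2_tendsto_iexp:
  assumes lim: "L2_tendsto M F f"
  shows "(\<lambda>m. CLINT \<omega>|M. iexp (s * F m \<omega>)) \<longlonglongrightarrow> (CLINT \<omega>|M. iexp (s * f \<omega>))"
proof (rule LIM_zero_cancel, rule tendsto_norm_zero_cancel)
  have [measurable]: "\<And>m. F m \<in> borel_measurable M" "f \<in> borel_measurable M"
    using lim by (auto simp: L2_tendsto_def)
  let ?d = "\<lambda>m. expectation (\<lambda>\<omega>. (F m \<omega> - f \<omega>)\<^sup>2)"
  show "(\<lambda>m. norm ((CLINT \<omega>|M. iexp (s * F m \<omega>)) - (CLINT \<omega>|M. iexp (s * f \<omega>)))) \<longlonglongrightarrow> 0"
  proof (rule tendsto_sandwich[of "\<lambda>_. 0" _ _ "\<lambda>m. \<bar>s\<bar> * sqrt (?d m)"])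
    have "(\<lambda>m. \<bar>s\<bar> * sqrt (?d m)) \<longlonglongrightarrow> \<bar>s\<bar> * sqrt 0"
      by (intro tendsto_intros L2_tendsto_real(2)[OF lim])
    then show "(\<lambda>m. \<bar>s\<bar> * sqrt (?d m)) \<longlonglongrightarrow> 0" by simp
    show "\<forall>\<^sub>F m in sequentially.
        norm ((CLINT \<omega>|M. iexp (s * F m \<omega>)) - (CLINT \<omega>|M. iexp (s * f \<omega>))) \<le> \<bar>s\<bar> * sqrt (?d m)"
      using L2_tendsto_real(1)[OF lim]
    proof eventually_elim
      fix m assume m: "integrable M (\<lambda>\<omega>. (F m \<omega> - f \<omega>)\<^sup>2)"
      have int: "integrable M (\<lambda>\<omega>. iexp (s * F m \<omega>))" "integrable M (\<lambda>\<omega>. iexp (s * f \<omega>))"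
        by (auto intro!: integrable_iexp)
      note D = expectation_abs_le_sqrt[OF _ m]
      have "norm ((CLINT \<omega>|M. iexp (s * F m \<omega>)) - (CLINT \<omega>|M. iexp (s * f \<omega>))) =
          norm (CLINT \<omega>|M. iexp (s * F m \<omega>) - iexp (s * f \<omega>))"
        using int by simp
      also have "\<dots> \<le> expectation (\<lambda>\<omega>. norm (iexp (s * F m \<omega>) - iexp (s * f \<omega>)))"
        by (rule integral_norm_bound)
      also have "\<dots> \<le> expectation (\<lambda>\<omega>. \<bar>s\<bar> * \<bar>F m \<omega> - f \<omega>\<bar>)"
      proof (rule integral_mono)
        show "integrable M (\<lambda>\<omega>. \<bar>s\<bar> * \<bar>F m \<omega> - f \<omega>\<bar>)" using D(1) by simp
        show "norm (iexp (s * F m \<omega>) - iexp (s * f \<omega>)) \<le> \<bar>s\<bar> * \<bar>F m \<omega> - f \<omega>\<bar>" for \<omega>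
          using iexp_diff_le[of "s * F m \<omega>" "s * f \<omega>"]
          by (simp only: right_diff_distrib[symmetric] abs_mult)
      qed (use int in auto)
      also have "\<dots> = \<bar>s\<bar> * expectation (\<lambda>\<omega>. \<bar>F m \<omega> - f \<omega>\<bar>)" by simp
      also have "\<dots> \<le> \<bar>s\<bar> * sqrt (?d m)" by (intro mult_left_mono D) auto
      finally show "norm ((CLINT \<omega>|M. iexp (s * F m \<omega>)) - (CLINT \<omega>|M. iexp (s * f \<omega>))) \<le>
          \<bar>s\<bar> * sqrt (?d m)" .
    qed
  qed auto
qed

section \<open>The Wiener integral\<close>

abbreviation unit_interval :: "real measure" where
  "unit_interval \<equiv> restrict_space lborel {0..1}"

lemma step_fun_measurable[measurable]: "step_fun \<phi> \<in> borel_measurable borel"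
proof (induction \<phi>)
  case Nil
  then show ?case by (simp add: step_fun_def)
next
  case (Cons x \<phi>)
  obtain c a b where "x = (c, a, b)" by (cases x)
  then have "step_fun (x # \<phi>) = (\<lambda>u. c * indicator {a<..b} u + step_fun \<phi> u)"
    by (auto simp: step_fun_def)
  with Cons show ?case by simp
qed

lemma step_fun_append: "step_fun (\<phi> @ \<psi>) u = step_fun \<phi> u + step_fun \<psi> u"
  by (simp add: step_fun_def)

lemma step_integral_append:
  "step_integral W (\<phi> @ \<psi>) \<omega> = step_integral W \<phi> \<omega> + step_integral W \<psi> \<omega>"
  by (simp add: step_integral_def)

lemma step01_append: "step01 (\<phi> @ \<psi>) \<longleftrightarrow> step01 \<phi> \<and> step01 \<psi>"
  by (simp add: step01_def ball_Un)

definition step_scale :: "real \<Rightarrow> step \<Rightarrow> step" where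
  "step_scale r \<phi> = map (\<lambda>(c, a, b). (r * c, a, b)) \<phi>"

lemma step_fun_scale: "step_fun (step_scale r \<phi>) u = r * step_fun \<phi> u"
  unfolding step_fun_def step_scale_def
  by (induction \<phi>) (auto simp: algebra_simps)

lemma step_integral_scale: "step_integral W (step_scale r \<phi>) \<omega> = r * step_integral W \<phi> \<omega>"
  unfolding step_integral_def step_scale_def
  by (induction \<phi>) (auto simp: algebra_simps)

lemma step01_scale: "step01 \<phi> \<Longrightarrow> step01 (step_scale r \<phi>)"
  by (auto simp: step01_def step_scale_def)

lemma square_integral_unit_interval: "square_integral f = (LINT u|unit_interval. (f u)\<^sup>2)"
  unfolding square_integral_def set_lebesgue_integral_def
  by (subst integral_restrict_space) (auto simp: mult.commute)

lemma step_fun_bounded: "\<bar>step_fun \<phi> u\<bar> \<le> (\<Sum>(c, a, b)\<leftarrow>\<phi>. \<bar>c\<bar>)"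
  unfolding step_fun_def
  by (induction \<phi>) (auto simp: indicator_def intro: order_trans[OF abs_triangle_ineq])

lemma prob_space_unit_interval: "prob_space unit_interval"
  by (rule prob_spaceI) (simp add: emeasure_restrict_space space_restrict_space)

lemma measurable_unit_interval: "f \<in> borel_measurable borel \<Longrightarrow> f \<in> borel_measurable unit_interval"
  by (intro measurable_restrict_space1) simp

lemma brownian_measurable:
  "standard_brownian_motion M W \<Longrightarrow> t \<in> {0..1} \<Longrightarrow> W t \<in> borel_measurable M"
  by (simp add: standard_brownian_motion_def)

lemma step_integral_measurable:
  assumes W: "standard_brownian_motion M W" and "step01 \<phi>"
  shows "step_integral W \<phi> \<in> borel_measurable M"
  using assms(2)
proof (induction \<phi>)
  case Nil
  then show ?case by (simp add: step_integral_def)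
next
  case (Cons x \<phi>)
  obtain c a b where x: "x = (c, a, b)" by (cases x)
  then have "W a \<in> borel_measurable M" "W b \<in> borel_measurable M" "step01 \<phi>"
    using Cons.prems brownian_measurable[OF W] by (auto simp: step01_def)
  moreover have "step_integral W (x # \<phi>) = (\<lambda>\<omega>. c * (W b \<omega> - W a \<omega>) + step_integral W \<phi> \<omega>)"
    by (auto simp: step_integral_def x)
  ultimately show ?case using Cons.IH by simp
qed

lemma has_wiener_integral_iff:
  assumes W: "standard_brownian_motion M W"
  shows "has_wiener_integral M W f I \<longleftrightarrow> f \<in> borel_measurable borel \<and>
    (\<exists>\<phi>. (\<forall>m. step01 (\<phi> m)) \<and> L2_tendsto unit_interval (\<lambda>m. step_fun (\<phi> m)) f \<and>
       L2_tendsto M (\<lambda>m. step_integral W (\<phi> m)) I)"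
proof -
  have "(\<integral>\<^sup>+u\<in>{0..1}. g u \<partial>lborel) = (\<integral>\<^sup>+u. g u \<partial>unit_interval)" for g
    by (subst nn_integral_restrict_space) auto
  then show ?thesis
    unfolding has_wiener_integral_def L2_tendsto_def
    using step_integral_measurable[OF W] measurable_unit_interval step_fun_measurable
    by (auto; blast)
qed

lemma has_wiener_integral_add:
  assumes W: "standard_brownian_motion M W"
    and "has_wiener_integral M W f I" "has_wiener_integral M W g J"
  shows "has_wiener_integral M W (\<lambda>u. f u + g u) (\<lambda>\<omega>. I \<omega> + J \<omega>)"
proof -
  obtain \<phi> \<psi> where \<phi>: "\<And>m. step01 (\<phi> m)" "L2_tendsto unit_interval (\<lambda>m. step_fun (\<phi> m)) f"
      "L2_tendsto M (\<lambda>m. step_integral W (\<phi> m)) I"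
    and \<psi>: "\<And>m. step01 (\<psi> m)" "L2_tendsto unit_interval (\<lambda>m. step_fun (\<psi> m)) g"
      "L2_tendsto M (\<lambda>m. step_integral W (\<psi> m)) J"
    and [measurable]: "f \<in> borel_measurable borel" "g \<in> borel_measurable borel"
    using assms(2,3) unfolding has_wiener_integral_iff[OF W] by blast
  have "L2_tendsto unit_interval (\<lambda>m. step_fun (\<phi> m @ \<psi> m)) (\<lambda>u. f u + g u)"
    using L2_tendsto_add[OF \<phi>(2) \<psi>(2)] by (simp add: step_fun_append[abs_def])
  moreover have "L2_tendsto M (\<lambda>m. step_integral W (\<phi> m @ \<psi> m)) (\<lambda>\<omega>. I \<omega> + J \<omega>)"
    using L2_tendsto_add[OF \<phi>(3) \<psi>(3)] by (simp add: step_integral_append[abs_def])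
  moreover have "\<forall>m. step01 (\<phi> m @ \<psi> m)" using \<phi>(1) \<psi>(1) by (simp add: step01_append)
  ultimately show ?thesis
    unfolding has_wiener_integral_iff[OF W] by (intro conjI exI[of _ "\<lambda>m. \<phi> m @ \<psi> m"]) auto
qed

lemma has_wiener_integral_cmult:
  assumes W: "standard_brownian_motion M W" and "has_wiener_integral M W f I"
  shows "has_wiener_integral M W (\<lambda>u. c * f u) (\<lambda>\<omega>. c * I \<omega>)"
proof -
  obtain \<phi> where \<phi>: "\<And>m. step01 (\<phi> m)" "L2_tendsto unit_interval (\<lambda>m. step_fun (\<phi> m)) f"
      "L2_tendsto M (\<lambda>m. step_integral W (\<phi> m)) I"
    and [measurable]: "f \<in> borel_measurable borel"
    using assms(2) unfolding has_wiener_integral_iff[OF W] by blast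
  have "L2_tendsto unit_interval (\<lambda>m. step_fun (step_scale c (\<phi> m))) (\<lambda>u. c * f u)"
    using L2_tendsto_cmult[OF \<phi>(2)] by (simp add: step_fun_scale[abs_def])
  moreover have "L2_tendsto M (\<lambda>m. step_integral W (step_scale c (\<phi> m))) (\<lambda>\<omega>. c * I \<omega>)"
    using L2_tendsto_cmult[OF \<phi>(3)] by (simp add: step_integral_scale[abs_def])
  moreover have "\<forall>m. step01 (step_scale c (\<phi> m))" using \<phi>(1) by (simp add: step01_scale)
  ultimately show ?thesis
    unfolding has_wiener_integral_iff[OF W] by (intro conjI exI[of _ "\<lambda>m. step_scale c (\<phi> m)"]) auto
qed

lemma has_wiener_integral_step:
  assumes W: "standard_brownian_motion M W" and "step01 \<phi>"
  shows "has_wiener_integral M W (step_fun \<phi>) (step_integral W \<phi>)"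
  unfolding has_wiener_integral_iff[OF W] using step_integral_measurable[OF W assms(2)] assms(2)
  by (auto intro!: exI[of _ "\<lambda>_. \<phi>"] simp: L2_tendsto_def measurable_unit_interval step_fun_measurable)

lemma has_wiener_integral_cong_AE:
  assumes W: "standard_brownian_motion M W" and "has_wiener_integral M W f I"
    and "AE \<omega> in M. I \<omega> = J \<omega>" "J \<in> borel_measurable M"
  shows "has_wiener_integral M W f J"
  using assms(2) L2_tendsto_cong_AE[OF _ assms(3,4)] unfolding has_wiener_integral_iff[OF W] by blast

lemma has_wiener_integral_sum:
  assumes W: "standard_brownian_motion M W" and "finite S"
    and "\<And>i. i \<in> S \<Longrightarrow> has_wiener_integral M W (f i) (I i)"
  shows "has_wiener_integral M W (\<lambda>u. \<Sum>i\<in>S. a i * f i u) (\<lambda>\<omega>. \<Sum>i\<in>S. a i * I i \<omega>)"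
  using assms(2,3)
proof (induction S rule: finite_induct)
  case empty
  show ?case
    using has_wiener_integral_step[OF W, of "[]"]
    by (simp add: step_fun_def[abs_def] step_integral_def[abs_def] step01_def)
next
  case (insert i S)
  then show ?case
    by (simp add: has_wiener_integral_add[OF W] has_wiener_integral_cmult[OF W])
qed

text \<open>
  Here the assumption that Brownian motion starts at \<open>0\<close> enters, and only almost surely.
\<close>

lemma has_wiener_integral_indicator:
  assumes W: "standard_brownian_motion M W" and t: "t \<in> {0..1}"
  shows "has_wiener_integral M W (indicator {0<..t}) (W t)"
proof (rule has_wiener_integral_cong_AE[OF W])
  have "step01 [(1, 0, t)]" using t by (simp add: step01_def)
  from has_wiener_integral_step[OF W this]
  show "has_wiener_integral M W (indicator {0<..t}) (\<lambda>\<omega>. W t \<omega> - W 0 \<omega>)"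
    by (simp add: step_fun_def[abs_def] step_integral_def[abs_def])
  have "AE \<omega> in M. W 0 \<omega> = 0" using W by (simp add: standard_brownian_motion_def)
  then show "AE \<omega> in M. W t \<omega> - W 0 \<omega> = W t \<omega>" by eventually_elim simp
qed (rule brownian_measurable[OF W t])

lemma integrable_step_fun_square: "integrable unit_interval (\<lambda>u. (step_fun \<phi> u)\<^sup>2)"
proof -
  interpret prob_space unit_interval by (rule prob_space_unit_interval)
  have [measurable]: "step_fun \<phi> \<in> borel_measurable unit_interval"
    by (rule measurable_unit_interval[OF step_fun_measurable])
  have "(step_fun \<phi> u)\<^sup>2 \<le> (\<Sum>(c, a, b)\<leftarrow>\<phi>. \<bar>c\<bar>)\<^sup>2" for u
    using power_mono[OF step_fun_bounded[of \<phi> u], of 2] by simp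
  then show ?thesis
    by (intro integrable_const_bound[where B="(\<Sum>(c, a, b)\<leftarrow>\<phi>. \<bar>c\<bar>)\<^sup>2"]) auto
qed

context prob_space
begin

text \<open>
  Both sides of the formula for the characteristic function of the integral of a step function
  are continuous with respect to \<open>L\<^sup>2\<close> convergence.
\<close>

lemma wiener_integral_normal:
  assumes W: "standard_brownian_motion M W" and "has_wiener_integral M W f I"
  shows "centered_normal M (square_integral f) I"
    and "integrable unit_interval (\<lambda>u. (f u)\<^sup>2)"
proof -
  obtain \<phi> where \<phi>: "\<And>m. step01 (\<phi> m)" "L2_tendsto unit_interval (\<lambda>m. step_fun (\<phi> m)) f"
      "L2_tendsto M (\<lambda>m. step_integral W (\<phi> m)) I"
    using assms(2) unfolding has_wiener_integral_iff[OF W] by blast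
  note norm = L2_tendsto_norm[OF \<phi>(2) integrable_step_fun_square]
  show "integrable unit_interval (\<lambda>u. (f u)\<^sup>2)" by (rule norm(1))
  have "(CLINT \<omega>|M. iexp (s * I \<omega>)) = exp (- (square_integral f * s\<^sup>2) / 2)" for s
  proof (rule LIMSEQ_unique)
    show "(\<lambda>m. CLINT \<omega>|M. iexp (s * step_integral W (\<phi> m) \<omega>)) \<longlonglongrightarrow> (CLINT \<omega>|M. iexp (s * I \<omega>))"
      by (rule L2_tendsto_iexp[OF \<phi>(3)])
    have "(CLINT \<omega>|M. iexp (s * step_integral W (\<phi> m) \<omega>)) =
        exp (- (square_integral (step_fun (\<phi> m)) * s\<^sup>2) / 2)" for m
      using step_integral_centered_normal[OF W \<phi>(1)[of m]] unfolding centered_normal_def by blast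
    moreover have "(\<lambda>m. complex_of_real (exp (- (square_integral (step_fun (\<phi> m)) * s\<^sup>2) / 2))) \<longlonglongrightarrow>
        complex_of_real (exp (- (square_integral f * s\<^sup>2) / 2))"
      using norm(2) unfolding square_integral_unit_interval by (intro tendsto_intros) auto
    ultimately show "(\<lambda>m. CLINT \<omega>|M. iexp (s * step_integral W (\<phi> m) \<omega>)) \<longlonglongrightarrow>
        complex_of_real (exp (- (square_integral f * s\<^sup>2) / 2))" by simp
  qed
  moreover have "I \<in> borel_measurable M" using \<phi>(3) by (simp add: L2_tendsto_def)
  moreover have "0 \<le> square_integral f"
    unfolding square_integral_unit_interval by simp
  ultimately show "centered_normal M (square_integral f) I"
    by (simp add: centered_normal_def)
qed

end

text \<open>
  The approximation is by left end point values on a grid finer than the modulus of continuity. The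
  point \<open>0\<close> is excluded because no interval \<open>{a<..b}\<close> in \<open>[0,1]\<close> contains it.
\<close>

lemma step_approximation:
  fixes f :: "real \<Rightarrow> real"
  assumes cont: "continuous_on {0..1} f" and "0 < e"
  obtains \<phi> where "step01 \<phi>" "\<And>u. u \<in> {0<..1} \<Longrightarrow> \<bar>step_fun \<phi> u - f u\<bar> \<le> e"
proof -
  have "uniformly_continuous_on {0..1} f"
    by (rule compact_uniformly_continuous[OF cont]) simp
  then obtain d where d: "0 < d"
    "\<And>x y. x \<in> {0..1} \<Longrightarrow> y \<in> {0..1} \<Longrightarrow> \<bar>y - x\<bar> < d \<Longrightarrow> \<bar>f y - f x\<bar> < e"
    using \<open>0 < e\<close> unfolding uniformly_continuous_on_def dist_real_def by metis
  obtain N :: nat where N: "inverse (real (Suc N)) < d"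
    using reals_Archimedean[OF d(1)] by blast
  define n where "n = Suc N"
  have n: "0 < n" "1 / real n < d" using N by (simp_all add: n_def inverse_eq_divide)
  define \<phi> where "\<phi> = map (\<lambda>i. (f (real i / n), real i / n, real (Suc i) / n)) [0..<n]"
  have "step01 \<phi>" using n by (auto simp: step01_def \<phi>_def divide_right_mono)
  moreover have "\<bar>step_fun \<phi> u - f u\<bar> \<le> e" if u: "u \<in> {0<..1}" for u
  proof -
    \<comment> \<open>the index of the grid interval \<open>{j / n<..(j + 1) / n}\<close> that contains \<open>u\<close>\<close>
    define j where "j = nat (\<lceil>u * n\<rceil> - 1)"
    have "0 < u * n" using u n by simp
    then have j_int: "int j = \<lceil>u * n\<rceil> - 1" unfolding j_def by simp
    have j: "real j < u * n" "u * n \<le> real j + 1"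
      using j_int by linarith+
    have "u * n \<le> 1 * real n" using u by (intro mult_right_mono) auto
    then have jn: "j < n" using j(1) by linarith
    have ind: "indicator {real i / n<..real (Suc i) / n} u = (if i = j then 1 else 0 :: real)" for i
    proof -
      have "u \<in> {real i / n<..real (Suc i) / n} \<longleftrightarrow> real i < u * n \<and> u * n \<le> real i + 1"
        using n by (auto simp: field_simps)
      also have "\<dots> \<longleftrightarrow> i = j"
        using j by (auto intro: le_antisym)
      finally show ?thesis by (simp add: indicator_def)
    qed
    have "step_fun \<phi> u = (\<Sum>i\<leftarrow>[0..<n]. f (real i / n) * indicator {real i / n<..real (Suc i) / n} u)"
      by (simp add: step_fun_def \<phi>_def o_def)
    also have "\<dots> = (\<Sum>i\<in>{0..<n}. f (real i / n) * (if i = j then 1 else 0))"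
      unfolding ind by (simp add: sum_list_distinct_conv_sum_set)
    also have "\<dots> = f (real j / n)" using jn by (simp add: mult_delta_right)
    finally have eq: "step_fun \<phi> u = f (real j / n)" .
    have "real j / n < u" "u \<le> (real j + 1) / n"
      using j n by (simp_all add: divide_less_eq le_divide_eq)
    then have "\<bar>real j / n - u\<bar> \<le> 1 / n"
      unfolding add_divide_distrib by linarith
    then have "\<bar>real j / n - u\<bar> < d" using n by linarith
    then have "\<bar>f (real j / n) - f u\<bar> < e"
      using u jn n by (intro d(2)) auto
    then show ?thesis unfolding eq by simp
  qed
  ultimately show thesis using that by blast
qed

lemma (in prob_space) nn_integral_square_le_of_bound:
  assumes "AE x in M. \<bar>g x\<bar> \<le> (c::real)"
  shows "(\<integral>\<^sup>+x. ennreal ((g x)\<^sup>2) \<partial>M) \<le> ennreal (c\<^sup>2)"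
proof -
  have "(\<integral>\<^sup>+x. ennreal ((g x)\<^sup>2) \<partial>M) \<le> (\<integral>\<^sup>+x. ennreal (c\<^sup>2) \<partial>M)"
  proof (rule nn_integral_mono_AE)
    show "AE x in M. ennreal ((g x)\<^sup>2) \<le> ennreal (c\<^sup>2)"
      using assms
    proof eventually_elim
      case (elim x)
      then show ?case using power_mono[OF elim, of 2] by (intro ennreal_leI) simp
    qed
  qed
  then show ?thesis by (simp add: emeasure_space_1)
qed

text \<open>
  The part of the completeness of \<open>L\<^sup>2\<close> that is needed. The increments \<open>X\<^sub>m\<^sub>+\<^sub>1 - X\<^sub>m\<close> have
  summable \<open>L\<^sup>1\<close> norms, so they are almost surely absolutely summable and \<open>X\<^sub>m\<close> converges almost surely;
  by Fatou's lemma the pointwise limit is also the limit in \<open>L\<^sup>2\<close>.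
\<close>

lemma (in prob_space) L2_fast_cauchy_limit:
  fixes X :: "nat \<Rightarrow> 'a \<Rightarrow> real"
  assumes [measurable]: "\<And>m. X m \<in> borel_measurable M"
    and fast: "\<And>m k. m \<le> k \<Longrightarrow> (\<integral>\<^sup>+\<omega>. ennreal ((X m \<omega> - X k \<omega>)\<^sup>2) \<partial>M) \<le> ennreal ((C * (1 / 2) ^ m)\<^sup>2)"
    and "0 \<le> C"
  obtains Y where "L2_tendsto M X Y"
proof -
  have L1: "(\<integral>\<^sup>+\<omega>. ennreal \<bar>X (Suc m) \<omega> - X m \<omega>\<bar> \<partial>M) \<le> ennreal (C * (1 / 2) ^ m)" for m
  proof -
    have "(\<integral>\<^sup>+\<omega>. ennreal ((X (Suc m) \<omega> - X m \<omega>)\<^sup>2) \<partial>M) \<le> ennreal ((C * (1 / 2) ^ m)\<^sup>2)"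
      using fast[of m "Suc m"] by (simp add: power2_commute)
    then have int: "integrable M (\<lambda>\<omega>. (X (Suc m) \<omega> - X m \<omega>)\<^sup>2)"
      by (auto simp: integrable_iff_bounded intro: le_less_trans)
    have "ennreal (expectation (\<lambda>\<omega>. (X (Suc m) \<omega> - X m \<omega>)\<^sup>2)) \<le> ennreal ((C * (1 / 2) ^ m)\<^sup>2)"
      using fast[of m "Suc m"] int by (subst nn_integral_eq_integral[symmetric]) (auto simp: power2_commute)
    then have "sqrt (expectation (\<lambda>\<omega>. (X (Suc m) \<omega> - X m \<omega>)\<^sup>2)) \<le> C * (1 / 2) ^ m"
      using \<open>0 \<le> C\<close> by (intro real_le_lsqrt) auto
    then have "expectation (\<lambda>\<omega>. \<bar>X (Suc m) \<omega> - X m \<omega>\<bar>) \<le> C * (1 / 2) ^ m"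
      using expectation_abs_le_sqrt(2)[OF _ int] by simp
    moreover have "integrable M (\<lambda>\<omega>. X (Suc m) \<omega> - X m \<omega>)"
      using expectation_abs_le_sqrt(1)[OF _ int] by simp
    ultimately show ?thesis
      by (subst nn_integral_eq_integral) (auto intro: ennreal_leI)
  qed
  have "(\<integral>\<^sup>+\<omega>. (\<Sum>m. ennreal \<bar>X (Suc m) \<omega> - X m \<omega>\<bar>) \<partial>M) =
      (\<Sum>m. \<integral>\<^sup>+\<omega>. ennreal \<bar>X (Suc m) \<omega> - X m \<omega>\<bar> \<partial>M)"
    by (rule nn_integral_suminf) measurable
  also have "\<dots> \<le> (\<Sum>m. ennreal (C * (1 / 2) ^ m))"
    by (rule suminf_le[OF L1]) auto
  also have "\<dots> = ennreal (\<Sum>m. C * (1 / 2) ^ m)"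
    using \<open>0 \<le> C\<close> by (intro suminf_ennreal2 summable_mult summable_geometric) auto
  also have "\<dots> < \<infinity>" by simp
  finally have "AE \<omega> in M. (\<Sum>m. ennreal \<bar>X (Suc m) \<omega> - X m \<omega>\<bar>) \<noteq> \<infinity>"
    by (intro nn_integral_PInf_AE) auto
  then have conv: "AE \<omega> in M. convergent (\<lambda>m. X m \<omega>)"
  proof eventually_elim
    case (elim \<omega>)
    then have "summable (\<lambda>m. \<bar>X (Suc m) \<omega> - X m \<omega>\<bar>)"
      by (intro summable_suminf_not_top) auto
    then have "summable (\<lambda>m. X (Suc m) \<omega> - X m \<omega>)" by (rule summable_rabs_cancel)
    then have "convergent (\<lambda>n. \<Sum>m<n. X (Suc m) \<omega> - X m \<omega>)"
      by (simp add: summable_iff_convergent)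
    then have "convergent (\<lambda>n. X n \<omega> - X 0 \<omega>)"
      unfolding sum_lessThan_telescope[of "\<lambda>m. X m \<omega>"] .
    then have "convergent (\<lambda>n. (X n \<omega> - X 0 \<omega>) + X 0 \<omega>)" by (intro convergent_add convergent_const)
    then show ?case by simp
  qed
  define Y where "Y \<omega> = lim (\<lambda>m. X m \<omega>)" for \<omega>
  have [measurable]: "Y \<in> borel_measurable M"
    unfolding Y_def by (rule borel_measurable_lim_metric) measurable
  have bound: "(\<integral>\<^sup>+\<omega>. ennreal ((X m \<omega> - Y \<omega>)\<^sup>2) \<partial>M) \<le> ennreal ((C * (1 / 2) ^ m)\<^sup>2)" for m
  proof -
    have "AE \<omega> in M. ennreal ((X m \<omega> - Y \<omega>)\<^sup>2) = liminf (\<lambda>k. ennreal ((X m \<omega> - X k \<omega>)\<^sup>2))"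
      using conv
    proof eventually_elim
      case (elim \<omega>)
      then have "(\<lambda>k. X k \<omega>) \<longlonglongrightarrow> Y \<omega>" unfolding Y_def by (simp add: convergent_LIMSEQ_iff)
      then have "(\<lambda>k. ennreal ((X m \<omega> - X k \<omega>)\<^sup>2)) \<longlonglongrightarrow> ennreal ((X m \<omega> - Y \<omega>)\<^sup>2)"
        by (intro tendsto_intros)
      then show ?case by (rule lim_imp_Liminf[OF sequentially_bot, symmetric])
    qed
    then have "(\<integral>\<^sup>+\<omega>. ennreal ((X m \<omega> - Y \<omega>)\<^sup>2) \<partial>M) =
        (\<integral>\<^sup>+\<omega>. liminf (\<lambda>k. ennreal ((X m \<omega> - X k \<omega>)\<^sup>2)) \<partial>M)"
      by (rule nn_integral_cong_AE)
    also have "\<dots> \<le> liminf (\<lambda>k. \<integral>\<^sup>+\<omega>. ennreal ((X m \<omega> - X k \<omega>)\<^sup>2) \<partial>M)"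
      by (rule nn_integral_liminf) measurable
    also have "\<dots> \<le> liminf (\<lambda>k. ennreal ((C * (1 / 2) ^ m)\<^sup>2))"
      by (rule Liminf_mono) (use fast in \<open>auto simp: eventually_sequentially\<close>)
    also have "\<dots> = ennreal ((C * (1 / 2) ^ m)\<^sup>2)" by (simp add: Liminf_const)
    finally show ?thesis .
  qed
  have "(\<lambda>m. ennreal ((C * (1 / 2) ^ m)\<^sup>2)) \<longlonglongrightarrow> ennreal ((C * 0)\<^sup>2)"
    by (intro tendsto_intros LIMSEQ_power_zero) auto
  then have lim0: "(\<lambda>m. ennreal ((C * (1 / 2) ^ m)\<^sup>2)) \<longlonglongrightarrow> 0"
    by (simp only: mult_zero_right zero_power2 ennreal_0)
  have "(\<lambda>m. \<integral>\<^sup>+\<omega>. ennreal ((X m \<omega> - Y \<omega>)\<^sup>2) \<partial>M) \<longlonglongrightarrow> 0"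
    by (rule tendsto_sandwich[OF _ _ tendsto_const lim0]) (auto intro!: always_eventually bound)
  then have "L2_tendsto M X Y" by (simp add: L2_tendsto_def)
  then show thesis by (rule that)
qed

text \<open>
  Uniform step approximations with errors \<open>2\<^sup>-\<^sup>m\<close> make the integrals a fast Cauchy sequence in
  \<open>L\<^sup>2\<close>, by the isometry.
\<close>

lemma (in prob_space) has_wiener_integral_continuous:
  assumes W: "standard_brownian_motion M W"
    and cont: "continuous_on {0..1} f" and [measurable]: "f \<in> borel_measurable borel"
  shows "\<exists>I. has_wiener_integral M W f I"
proof -
  interpret U: prob_space unit_interval by (rule prob_space_unit_interval)
  have "\<exists>\<phi>. step01 \<phi> \<and> (\<forall>u\<in>{0<..1}. \<bar>step_fun \<phi> u - f u\<bar> \<le> (1 / 2) ^ m)" for m :: nat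
    by (rule step_approximation[OF cont, of "(1 / 2) ^ m"]) auto
  then obtain \<phi> where \<phi>: "\<And>m. step01 (\<phi> m)"
    "\<And>m u. u \<in> {0<..1} \<Longrightarrow> \<bar>step_fun (\<phi> m) u - f u\<bar> \<le> (1 / 2) ^ m" by metis
  have "AE u in lborel. u \<noteq> (0::real)" by (rule AE_lborel_singleton)
  then have ae: "AE u in unit_interval. u \<in> {0<..1}"
    by (subst AE_restrict_space_iff) auto
  have fast: "(\<integral>\<^sup>+\<omega>. ennreal ((step_integral W (\<phi> m) \<omega> - step_integral W (\<phi> k) \<omega>)\<^sup>2) \<partial>M) \<le>
      ennreal ((2 * (1 / 2) ^ m)\<^sup>2)" if "m \<le> k" for m k
  proof -
    \<comment> \<open>the difference of two step functions, written as a single one\<close>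
    let ?\<psi> = "\<phi> m @ step_scale (- 1) (\<phi> k)"
    have "step01 ?\<psi>" using \<phi>(1) by (simp add: step01_append step01_scale)
    then have "(\<integral>\<^sup>+\<omega>. ennreal ((step_integral W ?\<psi> \<omega>)\<^sup>2) \<partial>M) = ennreal (square_integral (step_fun ?\<psi>))"
      by (intro centered_normal_moments(3) step_integral_centered_normal[OF W])
    also have "\<dots> = (\<integral>\<^sup>+u. ennreal ((step_fun ?\<psi> u)\<^sup>2) \<partial>unit_interval)"
      unfolding square_integral_unit_interval
      by (rule nn_integral_eq_integral[symmetric, OF integrable_step_fun_square]) simp
    also have "\<dots> \<le> ennreal ((2 * (1 / 2) ^ m)\<^sup>2)"
    proof (rule U.nn_integral_square_le_of_bound)
      show "AE u in unit_interval. \<bar>step_fun ?\<psi> u\<bar> \<le> 2 * (1 / 2) ^ m"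
        using ae
      proof eventually_elim
        case (elim u)
        have "(1 / 2 :: real) ^ k \<le> (1 / 2) ^ m" using that by (intro power_decreasing) auto
        then show ?case
          using \<phi>(2)[OF elim, of m] \<phi>(2)[OF elim, of k]
          unfolding step_fun_append step_fun_scale by linarith
      qed
    qed
    finally show ?thesis by (simp add: step_integral_append step_integral_scale)
  qed
  obtain I where I: "L2_tendsto M (\<lambda>m. step_integral W (\<phi> m)) I"
  proof (rule L2_fast_cauchy_limit[of "\<lambda>m. step_integral W (\<phi> m)" 2])
    show "step_integral W (\<phi> m) \<in> borel_measurable M" for m
      by (rule step_integral_measurable[OF W \<phi>(1)])
  qed (use fast in simp_all)
  have bound: "(\<integral>\<^sup>+u. ennreal ((step_fun (\<phi> m) u - f u)\<^sup>2) \<partial>unit_interval) \<le> ennreal (((1 / 2) ^ m)\<^sup>2)" for m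
    by (rule U.nn_integral_square_le_of_bound) (use ae \<phi>(2) in \<open>auto elim: eventually_mono\<close>)
  have "(\<lambda>m. ennreal (((1 / 2 :: real) ^ m)\<^sup>2)) \<longlonglongrightarrow> ennreal (0\<^sup>2)"
    by (intro tendsto_intros LIMSEQ_power_zero) auto
  then have lim0: "(\<lambda>m. ennreal (((1 / 2 :: real) ^ m)\<^sup>2)) \<longlonglongrightarrow> 0"
    by (simp only: zero_power2 ennreal_0)
  have "(\<lambda>m. \<integral>\<^sup>+u. ennreal ((step_fun (\<phi> m) u - f u)\<^sup>2) \<partial>unit_interval) \<longlonglongrightarrow> 0"
    by (rule tendsto_sandwich[OF _ _ tendsto_const lim0]) (auto intro!: always_eventually bound)
  then have "L2_tendsto unit_interval (\<lambda>m. step_fun (\<phi> m)) f"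
    by (simp add: L2_tendsto_def measurable_unit_interval step_fun_measurable)
  with I \<phi>(1) show ?thesis
    unfolding has_wiener_integral_iff[OF W] using assms(3) by blast
qed

lemma (in prob_space) has_wiener_integral_wiener_integral:
  assumes "standard_brownian_motion M W" "continuous_on {0..1} f" "f \<in> borel_measurable borel"
  shows "has_wiener_integral M W f (wiener_integral M W f)"
  unfolding wiener_integral_def by (rule someI_ex[OF has_wiener_integral_continuous[OF assms]])

section \<open>The Hilbert matrix\<close>

lemma has_integral_power_01: "((\<lambda>u::real. u ^ k) has_integral 1 / real (Suc k)) {0..1}"
proof -
  have "((\<lambda>u::real. u ^ k) has_integral (1 ^ Suc k / real (Suc k) - 0 ^ Suc k / real (Suc k))) {0..1}"
    by (rule fundamental_theorem_of_calculus)
      (auto simp flip: has_real_derivative_iff_has_vector_derivative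
        intro!: derivative_eq_intros simp del: power_Suc)
  then show ?thesis by simp
qed

text \<open>
  A polynomial of degree below \<open>n\<close> that is orthogonal to all monomials of degree below \<open>n\<close> is
  orthogonal to itself, so it vanishes on \<open>[0,1]\<close>.
\<close>

lemma polynomial_zero_of_orthogonal:
  fixes v :: "nat \<Rightarrow> real"
  assumes "\<And>k. k < n \<Longrightarrow> (\<Sum>j<n. v j / real (Suc (k + j))) = 0" "i < n"
  shows "v i = 0"
proof -
  let ?p = "\<lambda>u::real. \<Sum>j<n. v j * u ^ j"
  have sq: "(?p u)\<^sup>2 = (\<Sum>k<n. \<Sum>j<n. (v k * v j) * u ^ (k + j))" for u
    by (simp add: power2_eq_square sum_product power_add mult_ac)
  have "((\<lambda>u. (?p u)\<^sup>2) has_integral (\<Sum>k<n. \<Sum>j<n. (v k * v j) * (1 / real (Suc (k + j))))) {0..1}"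
    unfolding sq by (intro has_integral_sum has_integral_mult_right has_integral_power_01 finite_lessThan)
  also have "(\<Sum>k<n. \<Sum>j<n. (v k * v j) * (1 / real (Suc (k + j)))) =
      (\<Sum>k<n. v k * (\<Sum>j<n. v j / real (Suc (k + j))))"
    by (simp add: sum_distrib_left)
  also have "\<dots> = 0" using assms(1) by simp
  finally have int: "((\<lambda>u. (?p u)\<^sup>2) has_integral 0) (cbox 0 1)" by simp
  have zero: "(?p u)\<^sup>2 = 0" if "u \<in> {0..1}" for u
    by (rule has_integral_0_cbox_imp_0[OF _ _ int]) (use that in \<open>auto intro!: continuous_intros\<close>)
  obtain m where m: "n = Suc m" using assms(2) by (cases n) auto
  have "{0..1} \<subseteq> {u::real. (\<Sum>j\<le>m. v j * u ^ j) = 0}"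
    using zero by (auto simp: m lessThan_Suc_atMost)
  then have "infinite {u::real. (\<Sum>j\<le>m. v j * u ^ j) = 0}"
    by (rule infinite_super) simp
  then show ?thesis
    using polyfun_finite_roots[of v m] assms(2) m by (auto simp: less_Suc_eq_le)
qed

text \<open>
  The matrix with entries \<open>\<integral> u\<^sup>k u\<^sup>l du = 1 / (k + l + 1)\<close> over \<open>[0,1]\<close> is the Gram matrix of the monomials. It is
  nonsingular because a vector in its kernel is a polynomial as in the previous lemma.
\<close>

lemma hilbert_matrix_inverse:
  obtains B :: "nat \<Rightarrow> nat \<Rightarrow> real" where
    "\<And>i l. i < n \<Longrightarrow> l < n \<Longrightarrow> (\<Sum>k<n. B i k / real (Suc (k + l))) = (if i = l then 1 else 0)"
    "\<And>i l. i < n \<Longrightarrow> l < n \<Longrightarrow> (\<Sum>k<n. B k l / real (Suc (i + k))) = (if i = l then 1 else 0)"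
proof -
  define H where "H = mat n n (\<lambda>(i, j). 1 / real (Suc (i + j)))"
  have H: "H \<in> carrier_mat n n" by (simp add: H_def)
  have "det H \<noteq> 0"
  proof
    assume "det H = 0"
    then obtain v where v: "v \<in> carrier_vec n" "v \<noteq> 0\<^sub>v n" "H *\<^sub>v v = 0\<^sub>v n"
      using det_0_iff_vec_prod_zero_field[OF H] by auto
    have "(\<Sum>j<n. v $ j / real (Suc (k + j))) = 0" if "k < n" for k
    proof -
      have "(H *\<^sub>v v) $ k = 0" using v(3) that by simp
      then show ?thesis
        using that v(1) by (simp add: H_def scalar_prod_def atLeast0LessThan)
    qed
    then have "v $ i = 0" if "i < n" for i
      using polynomial_zero_of_orthogonal[of n "\<lambda>j. v $ j" i] that by simp
    then have "v = 0\<^sub>v n" using v(1) by (intro eq_vecI) auto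
    with v(2) show False by simp
  qed
  from det_non_zero_imp_unit[OF H this, of "()"]
  obtain C where C: "C \<in> carrier_mat n n" "C * H = 1\<^sub>m n" "H * C = 1\<^sub>m n"
    unfolding Units_def ring_mat_def by auto
  show thesis
  proof (rule that)
    fix i l assume il: "i < n" "l < n"
    have "(C * H) $$ (i, l) = (if i = l then 1 else 0)" using C il by simp
    then show "(\<Sum>k<n. C $$ (i, k) / real (Suc (k + l))) = (if i = l then 1 else 0)"
      using C(1) il by (simp add: H_def scalar_prod_def atLeast0LessThan)
    have "(H * C) $$ (i, l) = (if i = l then 1 else 0)" using C il by simp
    then show "(\<Sum>k<n. C $$ (k, l) / real (Suc (i + k))) = (if i = l then 1 else 0)"
      using C(1) il by (simp add: H_def scalar_prod_def atLeast0LessThan)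
  qed
qed

section \<open>Polynomials with prescribed moments\<close>

lemma has_bochner_integral_moment_indicator:
  assumes t: "t \<in> {0..1}"
  shows "has_bochner_integral unit_interval (\<lambda>u. indicator {0<..t} u * u ^ k) (t ^ Suc k / real (Suc k))"
proof -
  have "set_integrable lborel {0..t} (\<lambda>u. u ^ k)"
    by (intro borel_integrable_atLeastAtMost' continuous_intros)
  then have "integrable lborel (\<lambda>u. u ^ k * indicator {0..t} u)"
    by (simp add: set_integrable_def mult.commute)
  then have *: "has_bochner_integral lborel (\<lambda>u. u ^ k * indicator {0..t} u) (t ^ Suc k / real (Suc k))"
    using integral_power[of 0 t k] t by (simp add: has_bochner_integral_iff)
  have "AE u in lborel. u \<noteq> (0::real)" by (rule AE_lborel_singleton)
  then have ae: "AE u in lborel. u ^ k * indicator {0..t} u = indicator {0..1} u *\<^sub>R (indicator {0<..t} u * u ^ k)"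
    by eventually_elim (use t in \<open>auto simp: indicator_def\<close>)
  have "has_bochner_integral lborel (\<lambda>u. indicator {0..1} u *\<^sub>R (indicator {0<..t} u * u ^ k)) (t ^ Suc k / real (Suc k))"
    by (rule has_bochner_integral_cong_AE[THEN iffD1, OF _ _ ae *]) measurable
  then show ?thesis
    by (simp add: has_bochner_integral_iff integrable_restrict_space integral_restrict_space)
qed

lemma has_bochner_integral_moment:
  "has_bochner_integral unit_interval (\<lambda>u. u ^ k) (1 / real (Suc k))"
proof -
  have "AE u in lborel. u \<noteq> (0::real)" by (rule AE_lborel_singleton)
  then have ae: "AE u in unit_interval. indicator {0<..1} u * u ^ k = u ^ k"
    by (subst AE_restrict_space_iff) (auto simp: indicator_def)
  show ?thesis
    by (rule has_bochner_integral_cong_AE[THEN iffD1, OF _ _ ae])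
      (use has_bochner_integral_moment_indicator[of 1 k] in
        \<open>auto intro!: measurable_unit_interval\<close>)
qed

text \<open>
  In terms of the coefficients of the derivative, the moments are given by the Hilbert matrix.
\<close>

lemma pathwise_integral_polynomial:
  assumes X: "\<And>t. t \<in> {0..1} \<Longrightarrow> X t \<omega> = (\<Sum>j\<le>n. c j * t ^ j)"
  shows "pathwise_integral X (\<lambda>u. u ^ k) \<omega> =
    (\<Sum>i<n. (c (Suc i) * real (Suc i)) / real (Suc (k + i)))"
proof -
  have deriv: "vector_derivative (\<lambda>s. X s \<omega>) (at u within {0..1}) =
      (\<Sum>i<n. c (Suc i) * real (Suc i) * u ^ i)" if u: "u \<in> {0..1}" for u
  proof -
    have "((\<lambda>t. c 0 + (\<Sum>i<n. c (Suc i) * t ^ Suc i)) has_real_derivative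
        (\<Sum>i<n. c (Suc i) * real (Suc i) * u ^ i)) (at u within {0..1})"
      by (auto intro!: derivative_eq_intros sum.cong simp del: power_Suc)
    then have "((\<lambda>t. \<Sum>j\<le>n. c j * t ^ j) has_vector_derivative
        (\<Sum>i<n. c (Suc i) * real (Suc i) * u ^ i)) (at u within {0..1})"
      by (simp add: sum.atMost_shift has_real_derivative_iff_has_vector_derivative)
    then have "((\<lambda>s. X s \<omega>) has_vector_derivative
        (\<Sum>i<n. c (Suc i) * real (Suc i) * u ^ i)) (at u within {0..1})"
      by (rule has_vector_derivative_transform[OF u, rotated]) (use X in simp)
    then show ?thesis
      using vector_derivative_within_cbox[of 0 1 u "\<lambda>s. X s \<omega>"] u by simp
  qed
  have "pathwise_integral X (\<lambda>u. u ^ k) \<omega> =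
      (LBINT u:{0..1}. (\<Sum>i<n. (c (Suc i) * real (Suc i)) * u ^ (k + i)))"
    unfolding pathwise_integral_def
    by (rule set_lebesgue_integral_cong)
      (simp_all add: deriv sum_distrib_left power_add mult_ac)
  also have "\<dots> = (LINT u|unit_interval. (\<Sum>i<n. (c (Suc i) * real (Suc i)) * u ^ (k + i)))"
    unfolding set_lebesgue_integral_def by (subst integral_restrict_space) auto
  also have "\<dots> = (\<Sum>i<n. (c (Suc i) * real (Suc i)) * (1 / real (Suc (k + i))))"
    by (intro has_bochner_integral_integral_eq has_bochner_integral_sum
        has_bochner_integral_mult_right has_bochner_integral_moment)
  finally show ?thesis by simp
qed

text \<open>
  For the inverse \<open>B\<close> of the Hilbert matrix, \<open>\<Sum>\<^sub>k B i k \<xi>\<^sub>k\<close> is the \<open>i\<close>-th coefficient of the derivative of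
  the polynomial with moments \<open>\<xi>\<^sub>k\<close>. Integrating from \<open>0\<close> to \<open>t\<close> gives \<open>\<Sum>\<^sub>k interpolation_coeff B n t k * \<xi>\<^sub>k\<close> as
  its value at \<open>t\<close>.
\<close>

definition interpolation_coeff :: "(nat \<Rightarrow> nat \<Rightarrow> real) \<Rightarrow> nat \<Rightarrow> real \<Rightarrow> nat \<Rightarrow> real" where
  "interpolation_coeff B n t k = (\<Sum>i<n. t ^ Suc i / real (Suc i) * B i k)"

text \<open>
  The polynomial \<open>\<Sum>\<^sub>k interpolation_coeff B n t k * u\<^sup>k\<close> in \<open>u\<close> has the same moments of order below \<open>n\<close> as the
  indicator of \<open>{0<..t}\<close>: it is the orthogonal projection of this indicator.
\<close>

lemma interpolation_coeff_moment:
  assumes B: "\<And>i l. i < n \<Longrightarrow> l < n \<Longrightarrow> (\<Sum>k<n. B i k / real (Suc (k + l))) = (if i = l then 1 else 0)"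
    and "l < n"
  shows "(\<Sum>k<n. interpolation_coeff B n t k * (1 / real (Suc (k + l)))) = t ^ Suc l / real (Suc l)"
proof -
  have "(\<Sum>k<n. interpolation_coeff B n t k * (1 / real (Suc (k + l)))) =
      (\<Sum>k<n. \<Sum>i<n. t ^ Suc i / real (Suc i) * (B i k / real (Suc (k + l))))"
    by (simp add: interpolation_coeff_def sum_divide_distrib del: power_Suc)
  also have "\<dots> = (\<Sum>i<n. t ^ Suc i / real (Suc i) * (\<Sum>k<n. B i k / real (Suc (k + l))))"
    by (subst sum.swap) (simp add: sum_distrib_left del: power_Suc)
  also have "\<dots> = (\<Sum>i<n. t ^ Suc i / real (Suc i) * (if i = l then 1 else 0))"
    using B \<open>l < n\<close> by (intro sum.cong) auto
  also have "\<dots> = t ^ Suc l / real (Suc l)"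
    using \<open>l < n\<close> by (simp add: mult_delta_right del: power_Suc)
  finally show ?thesis .
qed

text \<open>
  The moment conditions are a linear system for the coefficients of the derivative; the root at \<open>0\<close>
  fixes the constant term. A left inverse of the Hilbert matrix solves the system.
\<close>

lemma matches_moments_unique:
  assumes B: "\<And>i l. i < n \<Longrightarrow> l < n \<Longrightarrow> (\<Sum>k<n. B i k / real (Suc (k + l))) = (if i = l then 1 else 0)"
    and X: "matches_moments M W n X"
  shows "AE \<omega> in M. \<forall>t\<in>{0..1}.
    X t \<omega> = (\<Sum>k<n. interpolation_coeff B n t k * wiener_integral M W (\<lambda>u. u ^ k) \<omega>)"
proof -
  obtain c where c: "\<And>t \<omega>. t \<in> {0..1} \<Longrightarrow> \<omega> \<in> space M \<Longrightarrow> X t \<omega> = (\<Sum>j\<le>n. c j \<omega> * t ^ j)"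
    using X unfolding matches_moments_def random_polynomial_def by blast
  have "AE \<omega> in M. \<forall>k\<in>{..<n}.
      pathwise_integral X (\<lambda>u. u ^ k) \<omega> = wiener_integral M W (\<lambda>u. u ^ k) \<omega>"
    using X unfolding matches_moments_def by (intro eventually_ball_finite) auto
  moreover have "AE \<omega> in M. X 0 \<omega> = 0" using X by (simp add: matches_moments_def)
  moreover have "AE \<omega> in M. \<omega> \<in> space M" by (rule AE_space)
  ultimately show ?thesis
  proof eventually_elim
    case (elim \<omega>)
    let ?\<xi> = "\<lambda>k. wiener_integral M W (\<lambda>u. u ^ k) \<omega>"
    define d where "d i = c (Suc i) \<omega> * real (Suc i)" for i
    have \<xi>: "?\<xi> k = (\<Sum>l<n. d l / real (Suc (k + l)))" if "k < n" for k
      using elim(1) that pathwise_integral_polynomial[of X \<omega> "\<lambda>j. c j \<omega>" n k] c[OF _ elim(3)]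
      by (simp add: d_def)
    have c0: "c 0 \<omega> = 0"
      using c[of 0 \<omega>] elim(2,3) by (simp add: sum.atMost_shift)
    show ?case
    proof
      fix t :: real assume t: "t \<in> {0..1}"
      have "(\<Sum>k<n. interpolation_coeff B n t k * ?\<xi> k) =
          (\<Sum>k<n. \<Sum>l<n. d l * (interpolation_coeff B n t k * (1 / real (Suc (k + l)))))"
        by (simp add: \<xi> sum_distrib_left mult_ac)
      also have "\<dots> = (\<Sum>l<n. d l * (\<Sum>k<n. interpolation_coeff B n t k * (1 / real (Suc (k + l)))))"
        by (subst sum.swap) (simp only: sum_distrib_left)
      also have "\<dots> = (\<Sum>l<n. d l * (t ^ Suc l / real (Suc l)))"
        using interpolation_coeff_moment[of n B] B by (intro sum.cong) auto
      also have "\<dots> = (\<Sum>l<n. c (Suc l) \<omega> * t ^ Suc l)"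
        by (intro sum.cong) (simp_all add: d_def del: power_Suc of_nat_Suc)
      also have "\<dots> = X t \<omega>"
        using c[OF t elim(3)] c0 by (simp add: sum.atMost_shift)
      finally show "X t \<omega> = (\<Sum>k<n. interpolation_coeff B n t k * ?\<xi> k)" ..
    qed
  qed
qed

text \<open>
  Here \<open>B\<close> is used as a right inverse of the Hilbert matrix.
\<close>

lemma matches_moments_exists:
  assumes B: "\<And>i l. i < n \<Longrightarrow> l < n \<Longrightarrow> (\<Sum>k<n. B k l / real (Suc (i + k))) = (if i = l then 1 else 0)"
    and meas: "\<And>k. k < n \<Longrightarrow> wiener_integral M W (\<lambda>u. u ^ k) \<in> borel_measurable M"
  shows "matches_moments M W n
    (\<lambda>t \<omega>. \<Sum>k<n. interpolation_coeff B n t k * wiener_integral M W (\<lambda>u. u ^ k) \<omega>)"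
    (is "matches_moments M W n ?X")
proof -
  let ?\<xi> = "\<lambda>k. wiener_integral M W (\<lambda>u. u ^ k)"
  define d where "d i \<omega> = (\<Sum>k<n. B i k * ?\<xi> k \<omega>)" for i \<omega>
  define c where "c j \<omega> = (case j of 0 \<Rightarrow> 0 | Suc i \<Rightarrow> d i \<omega> / real (Suc i))" for j \<omega>
  have X: "?X t \<omega> = (\<Sum>j\<le>n. c j \<omega> * t ^ j)" for t \<omega>
  proof -
    have "?X t \<omega> = (\<Sum>k<n. \<Sum>i<n. t ^ Suc i / real (Suc i) * (B i k * ?\<xi> k \<omega>))"
      unfolding interpolation_coeff_def sum_distrib_right mult.assoc ..
    also have "\<dots> = (\<Sum>i<n. c (Suc i) \<omega> * t ^ Suc i)"
      by (subst sum.swap) (simp add: c_def d_def sum_distrib_left sum_divide_distrib mult.commute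
          del: power_Suc of_nat_Suc)
    also have "\<dots> = (\<Sum>j\<le>n. c j \<omega> * t ^ j)"
      by (simp add: sum.atMost_shift c_def)
    finally show ?thesis .
  qed
  have "c j \<in> borel_measurable M" for j
    using meas unfolding c_def d_def by (cases j) (auto intro!: borel_measurable_sum)
  then have "random_polynomial M n ?X"
    unfolding random_polynomial_def by (intro exI[of _ c]) (auto simp: X)
  moreover have "?X 0 \<omega> = 0" for \<omega>
    by (simp add: interpolation_coeff_def)
  moreover have "pathwise_integral ?X (\<lambda>u. u ^ l) \<omega> = ?\<xi> l \<omega>" if "l < n" for l \<omega>
  proof -
    have cd: "c (Suc i) \<omega> * real (Suc i) = d i \<omega>" for i
      by (simp add: c_def del: of_nat_Suc)
    have "pathwise_integral ?X (\<lambda>u. u ^ l) \<omega> =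
        (\<Sum>i<n. (c (Suc i) \<omega> * real (Suc i)) / real (Suc (l + i)))"
      by (rule pathwise_integral_polynomial) (rule X)
    also have "\<dots> = (\<Sum>i<n. \<Sum>k<n. ?\<xi> k \<omega> * (B i k / real (Suc (l + i))))"
      unfolding cd by (simp add: d_def sum_divide_distrib mult.commute del: of_nat_Suc)
    also have "\<dots> = (\<Sum>k<n. ?\<xi> k \<omega> * (\<Sum>i<n. B i k / real (Suc (l + i))))"
      by (subst sum.swap) (simp only: sum_distrib_left)
    also have "\<dots> = (\<Sum>k<n. ?\<xi> k \<omega> * (if l = k then 1 else 0))"
      using B[OF that] by (intro sum.cong) auto
    also have "\<dots> = ?\<xi> l \<omega>" using that by (simp add: mult_delta_right)
    finally show ?thesis .
  qed
  ultimately show ?thesis unfolding matches_moments_def by simp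
qed

text \<open>
  The covariance of two Wiener integrals is the inner product of the integrands, so this makes the
  residual process uncorrelated with the moments of Brownian motion.
\<close>

lemma interpolation_residual_orthogonal:
  assumes B: "\<And>i l. i < n \<Longrightarrow> l < n \<Longrightarrow> (\<Sum>k<n. B i k / real (Suc (k + l))) = (if i = l then 1 else 0)"
    and "l < n" "t \<in> {0..1}"
  shows "has_bochner_integral unit_interval
    (\<lambda>u. (indicator {0<..t} u - (\<Sum>k<n. interpolation_coeff B n t k * u ^ k)) * u ^ l) 0"
proof -
  have "has_bochner_integral unit_interval
      (\<lambda>u. indicator {0<..t} u * u ^ l - (\<Sum>k<n. interpolation_coeff B n t k * u ^ (k + l)))
      (t ^ Suc l / real (Suc l) - (\<Sum>k<n. interpolation_coeff B n t k * (1 / real (Suc (k + l)))))"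
    by (intro has_bochner_integral_diff has_bochner_integral_sum has_bochner_integral_mult_right
        has_bochner_integral_moment has_bochner_integral_moment_indicator assms)
  moreover have "(\<Sum>k<n. interpolation_coeff B n t k * (1 / real (Suc (k + l)))) =
      t ^ Suc l / real (Suc l)"
    by (rule interpolation_coeff_moment) (use B \<open>l < n\<close> in auto)
  ultimately show ?thesis
    by (simp only: diff_self) (simp add: left_diff_distrib sum_distrib_right power_add mult.assoc)
qed

section \<open>Decomposition of Brownian motion\<close>

theorem theorem1p1:
  fixes M :: "'a measure" and W :: "real \<Rightarrow> 'a \<Rightarrow> real" and n :: nat
  assumes "prob_space M"
    and "standard_brownian_motion M W"
    and "n \<ge> 1"
  shows "(\<exists>Wn. matches_moments M W n Wn) \<and>
    (\<forall>X Y. matches_moments M W n X \<longrightarrow> matches_moments M W n Y \<longrightarrow>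
       (AE \<omega> in M. \<forall>t\<in>{0..1}. X t \<omega> = Y t \<omega>)) \<and>
    (\<forall>Wn. matches_moments M W n Wn \<longrightarrow>
       (\<exists>Z. (\<forall>t\<in>{0..1}. \<forall>\<omega>\<in>space M. W t \<omega> = Wn t \<omega> + Z t \<omega>) \<and>
            gaussian_process M {0..1} Z \<and>
            centered_process M {0..1} Z \<and>
            independent_processes M {0..1} Z Wn))"
proof -
  interpret prob_space M by fact
  note W = assms(2)
  obtain B :: "nat \<Rightarrow> nat \<Rightarrow> real" where
    BH: "\<And>i l. i < n \<Longrightarrow> l < n \<Longrightarrow> (\<Sum>k<n. B i k / real (Suc (k + l))) = (if i = l then 1 else 0)" and
    HB: "\<And>i l. i < n \<Longrightarrow> l < n \<Longrightarrow> (\<Sum>k<n. B k l / real (Suc (i + k))) = (if i = l then 1 else 0)"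
    using hilbert_matrix_inverse[of n] by blast
  define A where "A = interpolation_coeff B n"
  define \<xi> where "\<xi> k = wiener_integral M W (\<lambda>u. u ^ k)" for k
  have \<xi>: "has_wiener_integral M W (\<lambda>u. u ^ k) (\<xi> k)" for k
    unfolding \<xi>_def
    by (rule has_wiener_integral_wiener_integral[OF W]) (auto intro!: continuous_intros)
  have meas_\<xi>: "\<xi> k \<in> borel_measurable M" for k
    using \<xi>[of k] by (simp add: has_wiener_integral_def)
  have unique: "AE \<omega> in M. \<forall>t\<in>{0..1}. X t \<omega> = (\<Sum>k<n. A t k * \<xi> k \<omega>)"
    if "matches_moments M W n X" for X
    unfolding A_def \<xi>_def by (rule matches_moments_unique) (use BH that in auto)
  have "\<exists>Wn. matches_moments M W n Wn"
    using matches_moments_exists[of n B M W, OF HB] meas_\<xi> unfolding \<xi>_def by blast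
  moreover have "AE \<omega> in M. \<forall>t\<in>{0..1}. X t \<omega> = Y t \<omega>"
    if "matches_moments M W n X" "matches_moments M W n Y" for X Y
    using unique[OF that(1)] unique[OF that(2)] by eventually_elim simp
  moreover have "\<exists>Z. (\<forall>t\<in>{0..1}. \<forall>\<omega>\<in>space M. W t \<omega> = Wn t \<omega> + Z t \<omega>) \<and>
      gaussian_process M {0..1} Z \<and> centered_process M {0..1} Z \<and>
      independent_processes M {0..1} Z Wn" if Wn: "matches_moments M W n Wn" for Wn
  proof -
    \<comment> \<open>\<open>Wn t\<close> and \<open>Z t\<close> will be the Wiener integrals of \<open>q t\<close> and \<open>r t\<close>\<close>
    define q where "q t u = (\<Sum>k<n. A t k * u ^ k)" for t u :: real
    define r where "r t u = indicator {0<..t} u - q t u" for t u :: real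
    define Z where "Z t \<omega> = W t \<omega> - Wn t \<omega>" for t \<omega>
    have meas_Wn: "Wn t \<in> borel_measurable M" if t: "t \<in> {0..1}" for t
    proof -
      obtain c where c: "\<And>j. j \<le> n \<Longrightarrow> c j \<in> borel_measurable M"
          "\<And>\<omega>. \<omega> \<in> space M \<Longrightarrow> Wn t \<omega> = (\<Sum>j\<le>n. c j \<omega> * t ^ j)"
        using Wn t unfolding matches_moments_def random_polynomial_def by blast
      have "(\<lambda>\<omega>. \<Sum>j\<le>n. c j \<omega> * t ^ j) \<in> borel_measurable M"
        using c(1) by (intro borel_measurable_sum borel_measurable_times) auto
      then show ?thesis using c(2) by (simp cong: measurable_cong)
    qed
    have int_Wn: "has_wiener_integral M W (q t) (Wn t)" if t: "t \<in> {0..1}" for t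
    proof (rule has_wiener_integral_cong_AE[OF W])
      show "has_wiener_integral M W (q t) (\<lambda>\<omega>. \<Sum>k<n. A t k * \<xi> k \<omega>)"
        unfolding q_def by (rule has_wiener_integral_sum[OF W _ \<xi>]) simp
      show "AE \<omega> in M. (\<Sum>k<n. A t k * \<xi> k \<omega>) = Wn t \<omega>"
        using unique[OF Wn] by eventually_elim (use t in simp)
    qed (rule meas_Wn[OF t])
    have int_Z: "has_wiener_integral M W (r t) (Z t)" if t: "t \<in> {0..1}" for t
      using has_wiener_integral_add[OF W has_wiener_integral_indicator[OF W t]
          has_wiener_integral_cmult[OF W int_Wn[OF t], of "- 1"]]
      by (simp add: r_def[abs_def] Z_def[abs_def])
    have sum_Z: "has_wiener_integral M W (\<lambda>u. \<Sum>t\<in>S. a t * r t u) (\<lambda>\<omega>. \<Sum>t\<in>S. a t * Z t \<omega>)"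
      if "finite S" "S \<subseteq> {0..1}" for S a
      using that by (intro has_wiener_integral_sum[OF W] int_Z) auto
    have sum_Wn: "has_wiener_integral M W (\<lambda>u. \<Sum>t\<in>S. b t * q t u) (\<lambda>\<omega>. \<Sum>t\<in>S. b t * Wn t \<omega>)"
      if "finite S" "S \<subseteq> {0..1}" for S b
      using that by (intro has_wiener_integral_sum[OF W] int_Wn) auto
    have "gaussian_process M {0..1} Z"
      unfolding gaussian_process_def
      using gaussian_rv_of_centered_normal wiener_integral_normal(1)[OF W] sum_Z by blast
    moreover have "centered_process M {0..1} Z"
      unfolding centered_process_def
      using centered_normal_moments(1,2)[OF wiener_integral_normal(1)[OF W int_Z]] by blast
    moreover have "independent_processes M {0..1} Z Wn"
    proof (rule independent_processes_of_char)
      show "Z t \<in> borel_measurable M" if "t \<in> {0..1}" for t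
        using int_Z[OF that] by (simp add: has_wiener_integral_def)
      show "Wn t \<in> borel_measurable M" if "t \<in> {0..1}" for t by (rule meas_Wn[OF that])
      fix J K :: "real set" and a b :: "real \<Rightarrow> real"
      assume J: "finite J" "J \<subseteq> {0..1}" and K: "finite K" "K \<subseteq> {0..1}"
      define F where "F u = (\<Sum>t\<in>J. a t * r t u)" for u
      define G where "G u = (\<Sum>t\<in>K. b t * q t u)" for u
      define I where "I \<omega> = (\<Sum>t\<in>J. a t * Z t \<omega>)" for \<omega>
      define L where "L \<omega> = (\<Sum>t\<in>K. b t * Wn t \<omega>)" for \<omega>
      have FI: "has_wiener_integral M W F I" and GL: "has_wiener_integral M W G L"
        using sum_Z[OF J] sum_Wn[OF K] unfolding F_def G_def I_def L_def by auto
      note FGIL = has_wiener_integral_add[OF W FI GL]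
      have orth: "has_bochner_integral unit_interval (\<lambda>u. F u * G u) 0"
      proof -
        have "has_bochner_integral unit_interval
            (\<lambda>u. \<Sum>s\<in>J. \<Sum>t\<in>K. \<Sum>l<n. (a s * b t * A t l) * (r s u * u ^ l))
            (\<Sum>s\<in>J. \<Sum>t\<in>K. \<Sum>l<n. (a s * b t * A t l) * 0)"
          unfolding r_def q_def A_def
          using J by (intro has_bochner_integral_sum has_bochner_integral_mult_right
              interpolation_residual_orthogonal BH) auto
        moreover have "F u * G u = (\<Sum>s\<in>J. \<Sum>t\<in>K. \<Sum>l<n. (a s * b t * A t l) * (r s u * u ^ l))" for u
          unfolding F_def G_def sum_product
          by (simp add: q_def sum_distrib_left mult_ac)
        ultimately show ?thesis by simp
      qed
      have int: "integrable unit_interval (\<lambda>u. (F u)\<^sup>2)" "integrable unit_interval (\<lambda>u. (G u)\<^sup>2)"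
        using wiener_integral_normal(2)[OF W FI] wiener_integral_normal(2)[OF W GL] by auto
      have "square_integral (\<lambda>u. F u + G u) =
          (LINT u|unit_interval. (F u)\<^sup>2 + (G u)\<^sup>2 + 2 * (F u * G u))"
        unfolding square_integral_unit_interval by (simp add: power2_sum mult.assoc)
      also have "\<dots> = square_integral F + square_integral G"
        using int orth unfolding square_integral_unit_interval by (simp add: has_bochner_integral_iff)
      finally have pyth: "square_integral (\<lambda>u. F u + G u) = square_integral F + square_integral G" .
      have char: "(CLINT \<omega>|M. iexp (Q \<omega>)) = exp (- square_integral f / 2)"
        if "has_wiener_integral M W f Q" for f Q
      proof -
        have "(CLINT \<omega>|M. iexp (1 * Q \<omega>)) = exp (- (square_integral f * 1\<^sup>2) / 2)"
          using wiener_integral_normal(1)[OF W that] unfolding centered_normal_def by blast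
        then show ?thesis by simp
      qed
      have "(CLINT \<omega>|M. iexp (I \<omega>) * iexp (L \<omega>)) = (CLINT \<omega>|M. iexp (I \<omega> + L \<omega>))"
        by (simp add: distrib_left exp_add)
      also have "\<dots> = exp (- (square_integral F + square_integral G) / 2)"
        unfolding char[OF FGIL] pyth ..
      also have "\<dots> = (CLINT \<omega>|M. iexp (I \<omega>)) * (CLINT \<omega>|M. iexp (L \<omega>))"
        unfolding char[OF FI] char[OF GL] of_real_mult[symmetric] exp_add[symmetric]
        by (simp add: field_simps)
      finally show "(CLINT \<omega>|M. iexp (\<Sum>t\<in>J. a t * Z t \<omega>) * iexp (\<Sum>t\<in>K. b t * Wn t \<omega>)) =
          (CLINT \<omega>|M. iexp (\<Sum>t\<in>J. a t * Z t \<omega>)) * (CLINT \<omega>|M. iexp (\<Sum>t\<in>K. b t * Wn t \<omega>))"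
        unfolding I_def L_def .
    qed
    ultimately show ?thesis by (intro exI[of _ Z]) (simp add: Z_def)
  qed
  ultimately show ?thesis by blast
qed

end
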